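(* Let $1<k\le n$ and let $J\subseteq C(n,k)$ be a realizable $k$-set. The map $r\mapsto\mathrm{Inv}(r)$ is an isomorphism of posets between (1) the set $\overline{\mathrm{Paths}}_{k-1}(\emptyset,J)$ of $\sim$-classes of paths from $\emptyset$ to $J$ in $B(n,k-1)$, ordered by $\le_{\mathrm{MS}}$, and (2) the set of all realizable $(k+1)$-sets $U\subseteq C(n,k+1)$ with $J_s\subseteq U\subseteq J_s\cup J_F$, ordered by the single step inclusion order on this set.
   Context: $C(n,k)$: $k$-subsets of $\{1,\dots,n\}$, lexicographic order on increasing sequences, antilexicographic = reverse. For $X\in C(n,k+1)$, $P_X=\{Y\in C(n,k):Y\subset X\}$ with lexicographic order; prefix/suffix = initial/final segment (possibly empty or all). For $A\subseteq C(n,k)$: $A_p$ (resp. $A_s$) = $\{X\in C(n,k+1):P_X\cap A$ a nonempty prefix (resp. suffix) of $P_X$, $\ne P_X\}$, $A_F=\{X:P_X\subseteq A\}$, $A_\emptyset=\{X:P_X\cap A=\emptyset\}$; $A$ is realizable if each $P_X\cap A$ is a prefix or suffix of $P_X$. A path from $\emptyset$ to $J$ in $B(n,k-1)$ is a total order $\gamma$ on $J$ every prefix of which is a realizable subset of $C(n,k)$ (via Ziegler's identification of $B(n,k-1)$ with realizable subsets of $C(n,k)$ under single-step inclusion). $\mathrm{Inv}(\gamma)=J_s\cup\{X\in J_F:\gamma|_{P_X}\text{ antilexicographic}\}$. Two paths are elementarily equivalent if they differ by swapping two adjacent elements not in a common $k$-packet $P_X$; $\sim$ is the generated equivalence relation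 (Inv is constant on classes). For a class $r$ and $X\in J_F$ with $P_X$ contiguous in some representative, $p_X(r)$ is the class obtained by reversing that block. $r\le_{\mathrm{MS}}r'$ iff there is a sequence $r=r_1,\dots,r_{l+1}=r'$ with $r_{j+1}=p_{X_j}(r_j)$, $X_j\in J_F$, $X_j\notin\mathrm{Inv}(r_j)$. The single step inclusion order on a collection $\mathfrak U$ of sets: $U\le\tilde U$ iff there is a chain $U=U_0\subset U_1\subset\dots\subset U_l=\tilde U$ in $\mathfrak U$ with $|U_j\setminus U_{j-1}|=1$. *)

theory Defs
  imports Main "HOL-Library.Sublist"
begin

definition ksets :: "nat \<Rightarrow> nat \<Rightarrow> nat set set" where
  "ksets n k = {X. X \<subseteq> {1..n} \<and> card X = k}"

definition lex_less :: "nat set \<Rightarrow> nat set \<Rightarrow> bool" where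
  "lex_less X Y \<longleftrightarrow> (sorted_list_of_set X, sorted_list_of_set Y) \<in> lexord less_than"

definition packet :: "nat \<Rightarrow> nat \<Rightarrow> nat set \<Rightarrow> nat set set" where
  "packet n k X = {Y \<in> ksets n k. Y \<subset> X}"

text \<open>Prefixes and suffixes of a set \<open>P\<close> with respect to the lexicographic order; both
  the empty set and \<open>P\<close> itself qualify.\<close>

definition lex_prefix :: "nat set set \<Rightarrow> nat set set \<Rightarrow> bool" where
  "lex_prefix Q P \<longleftrightarrow> Q \<subseteq> P \<and> (\<forall>y\<in>Q. \<forall>x\<in>P. lex_less x y \<longrightarrow> x \<in> Q)"

definition lex_suffix :: "nat set set \<Rightarrow> nat set set \<Rightarrow> bool" where
  "lex_suffix Q P \<longleftrightarrow> Q \<subseteq> P \<and> (\<forall>y\<in>Q. \<forall>x\<in>P. lex_less y x \<longrightarrow> x \<in> Q)"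

definition realizable :: "nat \<Rightarrow> nat \<Rightarrow> nat set set \<Rightarrow> bool" where
  "realizable n k A \<longleftrightarrow> A \<subseteq> ksets n k \<and>
     (\<forall>X \<in> ksets n (k + 1). lex_prefix (packet n k X \<inter> A) (packet n k X) \<or>
                             lex_suffix (packet n k X \<inter> A) (packet n k X))"

definition suffix_part :: "nat \<Rightarrow> nat \<Rightarrow> nat set set \<Rightarrow> nat set set" where
  "suffix_part n k A = {X \<in> ksets n (k + 1).
     lex_suffix (packet n k X \<inter> A) (packet n k X) \<and>
     packet n k X \<inter> A \<noteq> {} \<and> packet n k X \<inter> A \<noteq> packet n k X}"

definition full_part :: "nat \<Rightarrow> nat \<Rightarrow> nat set set \<Rightarrow> nat set set" where
  "full_part n k A = {X \<in> ksets n (k + 1). packet n k X \<subseteq> A}"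

text \<open>A total order on the finite set \<open>J\<close> is encoded as the repetition-free list of its
  elements in increasing order. By Ziegler's identification of the higher Bruhat order
  \<open>B(n, k - 1)\<close> with the realizable subsets of \<open>C(n, k)\<close> under single-step inclusion, these
  lists are the paths from the empty set to \<open>J\<close> in \<open>B(n, k - 1)\<close>.\<close>

definition paths :: "nat \<Rightarrow> nat \<Rightarrow> nat set set \<Rightarrow> nat set list set" where
  "paths n k J = {\<gamma>. distinct \<gamma> \<and> set \<gamma> = J \<and>
     (\<forall>xs. prefix xs \<gamma> \<longrightarrow> realizable n k (set xs))}"

definition Inv :: "nat \<Rightarrow> nat \<Rightarrow> nat set list \<Rightarrow> nat set set" where
  "Inv n k \<gamma> = suffix_part n k (set \<gamma>) \<union>
     {X \<in> full_part n k (set \<gamma>).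
        sorted_wrt (\<lambda>Y Z. lex_less Z Y) (filter (\<lambda>Y. Y \<in> packet n k X) \<gamma>)}"

definition elem_equiv :: "nat \<Rightarrow> nat \<Rightarrow> nat set set \<Rightarrow> nat set list \<Rightarrow> nat set list \<Rightarrow> bool" where
  "elem_equiv n k J \<gamma> \<gamma>' \<longleftrightarrow> \<gamma> \<in> paths n k J \<and> \<gamma>' \<in> paths n k J \<and>
     (\<exists>us a b vs. \<gamma> = us @ [a, b] @ vs \<and> \<gamma>' = us @ [b, a] @ vs \<and>
        \<not> (\<exists>X \<in> ksets n (k + 1). a \<in> packet n k X \<and> b \<in> packet n k X))"

definition path_equiv :: "nat \<Rightarrow> nat \<Rightarrow> nat set set \<Rightarrow> nat set list rel" where
  "path_equiv n k J = {(\<gamma>, \<gamma>'). \<gamma> \<in> paths n k J \<and> \<gamma>' \<in> paths n k J \<and>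
     equivclp (elem_equiv n k J) \<gamma> \<gamma>'}"

definition path_classes :: "nat \<Rightarrow> nat \<Rightarrow> nat set set \<Rightarrow> nat set list set set" where
  "path_classes n k J = paths n k J // path_equiv n k J"

text \<open>The common value of \<open>Inv\<close> on a class; see \<open>Inv_class_eq\<close> below.\<close>

definition Inv_class :: "nat \<Rightarrow> nat \<Rightarrow> nat set list set \<Rightarrow> nat set set" where
  "Inv_class n k r = the_elem (Inv n k ` r)"

text \<open>The graph of the partial map \<open>p\<^sub>X\<close>: \<open>packet_flip n k J X r r'\<close> says that \<open>X\<close> lies in the
  full part of \<open>J\<close>, that the packet of \<open>X\<close> is contiguous in some representative of \<open>r\<close>, and
  that reversing this block yields a representative of \<open>r'\<close>.\<close>

definition packet_flip ::
  "nat \<Rightarrow> nat \<Rightarrow> nat set set \<Rightarrow> nat set \<Rightarrow> nat set list set \<Rightarrow> nat set list set \<Rightarrow> bool" where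
  "packet_flip n k J X r r' \<longleftrightarrow> X \<in> full_part n k J \<and>
     (\<exists>us bs vs. us @ bs @ vs \<in> r \<and> set bs = packet n k X \<and>
        r' = path_equiv n k J `` {us @ rev bs @ vs})"

definition MS_step ::
  "nat \<Rightarrow> nat \<Rightarrow> nat set set \<Rightarrow> nat set list set \<Rightarrow> nat set list set \<Rightarrow> bool" where
  "MS_step n k J r r' \<longleftrightarrow> r \<in> path_classes n k J \<and> r' \<in> path_classes n k J \<and>
     (\<exists>X \<in> full_part n k J. X \<notin> Inv_class n k r \<and> packet_flip n k J X r r')"

definition MS_order :: "nat \<Rightarrow> nat \<Rightarrow> nat set set \<Rightarrow> nat set list set rel" where
  "MS_order n k J = {(r, r'). r \<in> path_classes n k J \<and> r' \<in> path_classes n k J \<and>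
     (MS_step n k J)\<^sup>*\<^sup>* r r'}"

definition single_step :: "'a set set \<Rightarrow> 'a set \<Rightarrow> 'a set \<Rightarrow> bool" where
  "single_step \<UU> U V \<longleftrightarrow> U \<in> \<UU> \<and> V \<in> \<UU> \<and> U \<subset> V \<and> card (V - U) = 1"

definition single_step_order :: "'a set set \<Rightarrow> 'a set rel" where
  "single_step_order \<UU> = {(U, V). U \<in> \<UU> \<and> V \<in> \<UU> \<and> (single_step \<UU>)\<^sup>*\<^sup>* U V}"

definition inversion_sets :: "nat \<Rightarrow> nat \<Rightarrow> nat set set \<Rightarrow> nat set set set" where
  "inversion_sets n k J = {U. realizable n (k + 1) U \<and>
     suffix_part n k J \<subseteq> U \<and> U \<subseteq> suffix_part n k J \<union> full_part n k J}"

definition poset_iso :: "'a set \<Rightarrow> 'a rel \<Rightarrow> 'b set \<Rightarrow> 'b rel \<Rightarrow> ('a \<Rightarrow> 'b) \<Rightarrow> bool" where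
  "poset_iso A r B s f \<longleftrightarrow> partial_order_on A r \<and> partial_order_on B s \<and> bij_betw f A B \<and>
     (\<forall>x\<in>A. \<forall>y\<in>A. (x, y) \<in> r \<longleftrightarrow> (f x, f y) \<in> s)"

lemma equiv_path_equiv: "equiv (paths n k J) (path_equiv n k J)"
proof (rule equivI)
  show "path_equiv n k J \<subseteq> paths n k J \<times> paths n k J"
    by (auto simp: path_equiv_def)
  show "refl_on (paths n k J) (path_equiv n k J)"
    by (simp add: refl_on_def path_equiv_def reflpD[OF reflp_equivclp])
  show "sym (path_equiv n k J)"
    unfolding path_equiv_def
    by (rule symI) (use equivclp_sym[of "elem_equiv n k J"] in simp)
  show "trans (path_equiv n k J)"
  proof (rule transI)
    fix x y z
    assume "(x, y) \<in> path_equiv n k J" "(y, z) \<in> path_equiv n k J"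
    then show "(x, z) \<in> path_equiv n k J"
      using transpD[OF transp_equivclp, of "elem_equiv n k J" x y z]
      unfolding path_equiv_def by simp
  qed
qed

lemma elem_equiv_Inv:
  assumes "elem_equiv n k J \<gamma> \<gamma>'"
  shows "Inv n k \<gamma> = Inv n k \<gamma>'"
proof -
  obtain us a b vs where *: "\<gamma> = us @ [a, b] @ vs" "\<gamma>' = us @ [b, a] @ vs"
    "\<not> (\<exists>X \<in> ksets n (k + 1). a \<in> packet n k X \<and> b \<in> packet n k X)"
    using assms unfolding elem_equiv_def by metis
  have st: "set \<gamma> = set \<gamma>'"
    unfolding *(1,2) by auto
  have "filter (\<lambda>Y. Y \<in> packet n k X) \<gamma> = filter (\<lambda>Y. Y \<in> packet n k X) \<gamma>'"
    if "X \<in> full_part n k (set \<gamma>')" for X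
  proof -
    have "\<not> (a \<in> packet n k X \<and> b \<in> packet n k X)"
      using *(3) that by (simp add: full_part_def)
    then show ?thesis
      unfolding *(1,2) by simp
  qed
  then have "{X \<in> full_part n k (set \<gamma>').
        sorted_wrt (\<lambda>Y Z. lex_less Z Y) (filter (\<lambda>Y. Y \<in> packet n k X) \<gamma>)} =
      {X \<in> full_part n k (set \<gamma>').
        sorted_wrt (\<lambda>Y Z. lex_less Z Y) (filter (\<lambda>Y. Y \<in> packet n k X) \<gamma>')}"
    by (intro Collect_cong conj_cong refl) simp
  then show ?thesis
    unfolding Inv_def st by simp
qed

lemma path_equiv_Inv:
  assumes "(\<gamma>, \<gamma>') \<in> path_equiv n k J"
  shows "Inv n k \<gamma> = Inv n k \<gamma>'"
proof -
  have "equivclp (elem_equiv n k J) \<gamma> \<gamma>'"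
    using assms by (simp add: path_equiv_def)
  then show ?thesis
  proof (induction rule: equivclp_induct)
    case (step \<gamma>1 \<gamma>2)
    then show ?case
      by (metis elem_equiv_Inv)
  qed simp
qed

lemma Inv_class_eq:
  assumes "r \<in> path_classes n k J" "\<gamma> \<in> r"
  shows "Inv_class n k r = Inv n k \<gamma>"
proof -
  have "Inv n k \<gamma>' = Inv n k \<gamma>" if "\<gamma>' \<in> r" for \<gamma>'
  proof (rule path_equiv_Inv)
    show "(\<gamma>', \<gamma>) \<in> path_equiv n k J"
      using quotient_eq_iff[OF equiv_path_equiv assms(1)[unfolded path_classes_def]
          assms(1)[unfolded path_classes_def] that assms(2)] by simp
  qed
  then have "Inv n k ` r = {Inv n k \<gamma>}"
    using assms(2) by blast
  then show ?thesis
    by (simp add: Inv_class_def)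
qed

end

theory Submission
  imports Defs
begin

text \<open>A set \<open>U\<close> of \<open>(k+1)\<close>-sets orients every packet: antilexicographically if it belongs to \<open>U\<close>,
  lexicographically otherwise. For realizable \<open>U\<close> the union of these orders on all \<open>k\<close>-sets is acyclic,
  by induction on \<open>n\<close> through deletion and contraction of the largest element. If moreover
  \<open>J\<^sub>s \<subseteq> U \<subseteq> J\<^sub>s \<union> J\<^sub>F\<close>, then \<open>J\<close> is a down-set of this relation, and the paths to \<open>J\<close> with inversion
  set \<open>U\<close> are exactly its linear extensions on \<open>J\<close>. This gives surjectivity, and injectivity because
  linear extensions are connected by transpositions of incomparable neighbours. Reversing a
  contiguous packet adds one element to the inversion set; conversely a packet can be made
  contiguous as soon as both \<open>U\<close> and \<open>U \<union> {X}\<close> are realizable.\<close>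

subsection \<open>Packets and the lexicographic order\<close>

lemma finite_ksets: "finite (ksets n k)"
  by (rule finite_subset[of _ "Pow {1..n}"]) (auto simp: ksets_def)

lemma ksets_finite: "X \<in> ksets n k \<Longrightarrow> finite X"
  by (auto simp: ksets_def intro: finite_subset)

lemma ksets_remove: "X \<in> ksets n (k + 1) \<Longrightarrow> x \<in> X \<Longrightarrow> X - {x} \<in> ksets n k"
  by (auto simp: ksets_def)

lemma packet_eq:
  assumes "X \<in> ksets n (k + 1)"
  shows "packet n k X = (\<lambda>x. X - {x}) ` X"
proof (intro equalityI subsetI)
  fix Y assume "Y \<in> packet n k X"
  then have Y: "Y \<subset> X" "card Y = k" by (auto simp: packet_def ksets_def)
  have "card (X - Y) = 1"
    using Y assms by (simp add: card_Diff_subset ksets_def psubset_imp_subset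
        finite_subset[OF psubset_imp_subset ksets_finite[OF assms]])
  then obtain x where "X - Y = {x}" by (auto simp: card_1_singleton_iff)
  then have "Y = X - {x}" "x \<in> X" using Y by auto
  then show "Y \<in> (\<lambda>x. X - {x}) ` X" by blast
next
  fix Y assume "Y \<in> (\<lambda>x. X - {x}) ` X"
  then show "Y \<in> packet n k X"
    using ksets_remove[OF assms] by (auto simp: packet_def)
qed

lemma remove_eq_iff: "x \<in> X \<Longrightarrow> y \<in> X \<Longrightarrow> X - {x} = X - {y} \<longleftrightarrow> x = y"
  by auto

text \<open>Both increasing sequences start with the elements below \<open>y\<close>. Then the first
  continues with \<open>y\<close>, the second with the least element of \<open>X\<close> above
  \<open>y\<close>, which exists because of \<open>x\<close>. On a packet the lexicographic order
  thus reverses the order of the removed elements.\<close>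

lemma lex_less_removeI:
  assumes "finite X" "x \<in> X" "y \<in> X" "y < x"
  shows "lex_less (X - {x}) (X - {y})"
proof -
  let ?L = "{z \<in> X. z < y}" and ?G = "{z \<in> X. y < z}"
  have split: "sorted_list_of_set (A \<union> B) = sorted_list_of_set A @ sorted_list_of_set B"
    if "finite A" "finite B" "\<And>a b. a \<in> A \<Longrightarrow> b \<in> B \<Longrightarrow> a < b" for A B :: "nat set"
  proof (rule sorted_distinct_set_unique)
    show "distinct (sorted_list_of_set A @ sorted_list_of_set B)"
      using that by fastforce
    show "sorted (sorted_list_of_set A @ sorted_list_of_set B)"
      using that by (fastforce simp: sorted_append intro: less_imp_le)
  qed (use that in auto)
  have "X - {x} = ?L \<union> ({y} \<union> (?G - {x}))" "X - {y} = ?L \<union> ?G"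
    using assms by auto
  moreover have "sorted_list_of_set (?L \<union> ({y} \<union> (?G - {x}))) =
      sorted_list_of_set ?L @ sorted_list_of_set ({y} \<union> (?G - {x}))"
    by (rule split) (use assms in auto)
  moreover have "sorted_list_of_set ({y} \<union> (?G - {x})) =
      sorted_list_of_set {y} @ sorted_list_of_set (?G - {x})"
    by (rule split) (use assms in auto)
  moreover have "sorted_list_of_set (?L \<union> ?G) = sorted_list_of_set ?L @ sorted_list_of_set ?G"
    by (rule split) (use assms in auto)
  moreover obtain g gs where g: "sorted_list_of_set ?G = g # gs"
    using assms by (cases "sorted_list_of_set ?G") auto
  moreover have "y < g"
  proof -
    have "g \<in> set (sorted_list_of_set ?G)" using g by simp
    then show ?thesis using assms by simp
  qed
  ultimately show ?thesis
    unfolding lex_less_def by (simp only:) (rule lexord_append_leftI, simp)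
qed

lemma lex_less_remove_iff:
  assumes "finite X" "x \<in> X" "y \<in> X"
  shows "lex_less (X - {x}) (X - {y}) \<longleftrightarrow> y < x"
proof -
  have asym: "\<not> (lex_less A B \<and> lex_less B A)" for A B
    unfolding lex_less_def
    using lexord_asymmetric[of less_than] by (metis asym_less_than)
  show ?thesis
    using lex_less_removeI[OF assms] lex_less_removeI[OF assms(1,3,2)]
      asym[of "X - {x}" "X - {y}"] asym[of "X - {x}" "X - {x}"]
    by (metis linorder_neqE_nat)
qed

lemma lex_prefix_packet_iff:
  assumes "X \<in> ksets n (k + 1)"
  shows "lex_prefix (packet n k X \<inter> A) (packet n k X) \<longleftrightarrow>
    (\<forall>x\<in>X. \<forall>y\<in>X. x < y \<longrightarrow> X - {x} \<in> A \<longrightarrow> X - {y} \<in> A)"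
  using lex_less_remove_iff[OF ksets_finite[OF assms]]
  by (auto simp: lex_prefix_def packet_eq[OF assms])

lemma lex_suffix_packet_iff:
  assumes "X \<in> ksets n (k + 1)"
  shows "lex_suffix (packet n k X \<inter> A) (packet n k X) \<longleftrightarrow>
    (\<forall>x\<in>X. \<forall>y\<in>X. x < y \<longrightarrow> X - {y} \<in> A \<longrightarrow> X - {x} \<in> A)"
  using lex_less_remove_iff[OF ksets_finite[OF assms]]
  by (auto simp: lex_suffix_def packet_eq[OF assms])

lemma realizable_iff:
  "realizable n k A \<longleftrightarrow> A \<subseteq> ksets n k \<and>
    (\<forall>X\<in>ksets n (k + 1).
      (\<forall>x\<in>X. \<forall>y\<in>X. x < y \<longrightarrow> X - {x} \<in> A \<longrightarrow> X - {y} \<in> A) \<or>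
      (\<forall>x\<in>X. \<forall>y\<in>X. x < y \<longrightarrow> X - {y} \<in> A \<longrightarrow> X - {x} \<in> A))"
  unfolding realizable_def
  by (intro conj_cong ball_cong refl) (simp only: lex_prefix_packet_iff lex_suffix_packet_iff)

text \<open>A predicate closed in neither direction has a descent \<open>x < y\<close> and a rise
  \<open>u < v\<close>. The smaller of \<open>x\<close> and \<open>u\<close> starts an alternating
  triple: \<open>x < u < v\<close> or \<open>u < x < y\<close>. In this form realizability is a
  condition on three removed elements.\<close>

lemma closed_iff_no_alternation:
  fixes X :: "'a::linorder set"
  shows "(\<forall>x\<in>X. \<forall>y\<in>X. x < y \<longrightarrow> P x \<longrightarrow> P y) \<or> (\<forall>x\<in>X. \<forall>y\<in>X. x < y \<longrightarrow> P y \<longrightarrow> P x) \<longleftrightarrow>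
    (\<forall>a\<in>X. \<forall>b\<in>X. \<forall>c\<in>X. a < b \<longrightarrow> b < c \<longrightarrow> P a = P c \<longrightarrow> P b = P a)"
  (is "?L \<longleftrightarrow> ?R")
proof
  assume R: ?R
  show ?L
  proof (rule ccontr)
    assume "\<not> ?L"
    then obtain x y u v where *: "x \<in> X" "y \<in> X" "u \<in> X" "v \<in> X" "x < y" "u < v"
      "P x" "\<not> P y" "P v" "\<not> P u" by blast
    then consider "x < u" | "u < x" by (metis linorder_neqE)
    then show False using * R by metis
  qed
qed metis

lemma realizable_iff_no_alternation:
  "realizable n k A \<longleftrightarrow> A \<subseteq> ksets n k \<and>
    (\<forall>X\<in>ksets n (k + 1). \<forall>a\<in>X. \<forall>b\<in>X. \<forall>c\<in>X. a < b \<longrightarrow> b < c \<longrightarrow>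
      (X - {a} \<in> A) = (X - {c} \<in> A) \<longrightarrow> (X - {b} \<in> A) = (X - {a} \<in> A))"
  unfolding realizable_iff
  by (intro conj_cong ball_cong refl) (rule closed_iff_no_alternation)

lemma realizable_no_alternation:
  assumes "realizable n k A" "X \<in> ksets n (k + 1)" "a \<in> X" "b \<in> X" "c \<in> X" "a < b" "b < c"
    "(X - {a} \<in> A) = (X - {c} \<in> A)"
  shows "(X - {b} \<in> A) = (X - {a} \<in> A)"
  using assms(1)[unfolded realizable_iff_no_alternation, THEN conjunct2, rule_format, OF assms(2-)] .

subsection \<open>The packet relation and its linear extensions\<close>

text \<open>A pair \<open>(Y, Z)\<close> asks that \<open>Y\<close> precede \<open>Z\<close>. As
  removing a smaller element leaves a lexicographically larger set, \<open>x < y\<close> encodes the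
  antilexicographic order. No transitive closure is taken.\<close>

definition packet_rel :: "nat \<Rightarrow> nat \<Rightarrow> nat set set \<Rightarrow> nat set rel" where
  "packet_rel n k U = {(X - {x}, X - {y}) | X x y. X \<in> ksets n (k + 1) \<and> x \<in> X \<and> y \<in> X \<and>
     (if X \<in> U then x < y else y < x)}"

lemma packet_relE:
  assumes "(Y, Z) \<in> packet_rel n k U"
  obtains X x y where "Y = X - {x}" "Z = X - {y}" "X \<in> ksets n (k + 1)" "x \<in> X" "y \<in> X"
    "x \<noteq> y" "if X \<in> U then x < y else y < x"
  using assms unfolding packet_rel_def by (auto split: if_splits)

lemma packet_relI:
  assumes "X \<in> ksets n (k + 1)" "x \<in> X" "y \<in> X" "if X \<in> U then x < y else y < x"
  shows "(X - {x}, X - {y}) \<in> packet_rel n k U"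
  using assms unfolding packet_rel_def by blast

text \<open>The union of two distinct members of a packet recovers \<open>X\<close>; hence no two
  packets prescribe the order of the same pair.\<close>

lemma remove_pair_unique:
  assumes "X - {x} = X' - {x'}" "X - {y} = X' - {y'}"
    "x \<in> X" "y \<in> X" "x' \<in> X'" "y' \<in> X'" "x \<noteq> y" "x' \<noteq> y'"
  shows "X = X'" "x = x'" "y = y'"
proof -
  have "X = (X - {x}) \<union> (X - {y})" "X' = (X' - {x'}) \<union> (X' - {y'})"
    using assms(3-) by auto
  then show "X = X'" using assms(1,2) by simp
  then show "x = x'" "y = y'" using assms by auto
qed

lemma packet_rel_remove_iff:
  assumes "X \<in> ksets n (k + 1)" "x \<in> X" "y \<in> X"
  shows "(X - {x}, X - {y}) \<in> packet_rel n k U \<longleftrightarrow> (if X \<in> U then x < y else y < x)"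
proof
  assume *: "(X - {x}, X - {y}) \<in> packet_rel n k U"
  then obtain X' x' y' where **: "X - {x} = X' - {x'}" "X - {y} = X' - {y'}" 
     "x' \<in> X'" "y' \<in> X'" "x' \<noteq> y'" "if X' \<in> U then x' < y' else y' < x'"
    by (elim packet_relE) blast
  then have "x \<noteq> y" by auto
  then show "if X \<in> U then x < y else y < x"
    using remove_pair_unique[OF **(1,2) assms(2,3) **(3,4)] ** by simp
qed (rule packet_relI[OF assms])

text \<open>Each packet is a chain of the relation, lexicographic or reversed. A down-set meets this
  chain in an initial segment, which is a prefix or a suffix of the packet.\<close>

lemma realizable_if_packet_rel_closed:
  assumes "A \<subseteq> ksets n k" "\<And>Y Z. (Y, Z) \<in> packet_rel n k U \<Longrightarrow> Z \<in> A \<Longrightarrow> Y \<in> A"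
  shows "realizable n k A"
  unfolding realizable_iff
proof (intro conjI ballI)
  fix X assume X: "X \<in> ksets n (k + 1)"
  show "(\<forall>x\<in>X. \<forall>y\<in>X. x < y \<longrightarrow> X - {x} \<in> A \<longrightarrow> X - {y} \<in> A) \<or>
      (\<forall>x\<in>X. \<forall>y\<in>X. x < y \<longrightarrow> X - {y} \<in> A \<longrightarrow> X - {x} \<in> A)"
    using packet_relI[OF X, of _ _ U] assms(2) by (cases "X \<in> U") (simp, blast)+
qed (rule assms(1))

text \<open>Only packets that meet \<open>J\<close> without being contained in it matter. For these,
  the bounds on \<open>U\<close> give \<open>X \<in> U\<close> exactly when \<open>J\<close> cuts
  out a suffix, so \<open>U\<close> orients the packet with its part in \<open>J\<close>
  first.\<close>

lemma packet_rel_closed: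
  assumes J: "realizable n k J" and U: "suffix_part n k J \<subseteq> U" "U \<subseteq> suffix_part n k J \<union> full_part n k J"
    and YZ: "(Y, Z) \<in> packet_rel n k U" "Z \<in> J"
  shows "Y \<in> J"
proof -
  obtain X x y where *: "Y = X - {x}" "Z = X - {y}" "X \<in> ksets n (k + 1)" "x \<in> X" "y \<in> X"
    "x \<noteq> y" "if X \<in> U then x < y else y < x" using YZ(1) by (rule packet_relE)
  have Yp: "Y \<in> packet n k X" and Zp: "Z \<in> packet n k X"
    using * by (auto simp: packet_eq)
  show ?thesis
  proof (cases "X \<in> full_part n k J")
    case True
    then show ?thesis using Yp by (auto simp: full_part_def)
  next
    case False
    then have ne: "packet n k X \<inter> J \<noteq> {}" "packet n k X \<inter> J \<noteq> packet n k X"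
      using *(3) Zp YZ(2) by (auto simp: full_part_def)
    show ?thesis
    proof (cases "X \<in> U")
      case True
      then have "X \<in> suffix_part n k J" using U(2) False by blast
      then show ?thesis
        using * True YZ(2) lex_suffix_packet_iff[OF *(3)] by (auto simp: suffix_part_def)
    next
      case xU: False
      then have "\<not> lex_suffix (packet n k X \<inter> J) (packet n k X)"
        using U(1) ne *(3) by (auto simp: suffix_part_def)
      then have "lex_prefix (packet n k X \<inter> J) (packet n k X)"
        using J *(3) by (auto simp: realizable_def)
      then show ?thesis
        using * xU YZ(2) lex_prefix_packet_iff[OF *(3)] by auto
    qed
  qed
qed

text \<open>\<open>R\<close> is not assumed to be an order, and only its own pairs are tested. A
  list of all elements of a finite set therefore certifies that \<open>R\<close> has no cycle of two
  or more distinct elements there.\<close>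

definition linear_extension :: "'a rel \<Rightarrow> 'a list \<Rightarrow> bool" where
  "linear_extension R \<gamma> \<longleftrightarrow> distinct \<gamma> \<and> sorted_wrt (\<lambda>x y. (y, x) \<notin> R) \<gamma>"

section \<open>Acyclicity of the packet relation by deletion and contraction\<close>

lemma realizable_deletion:
  assumes "realizable (Suc n) k U"
  shows "realizable n k (U \<inter> ksets n k)"
proof -
  have "ksets n (k+1) \<subseteq> ksets (Suc n) (k+1)" by (auto simp: ksets_def)
  then show ?thesis using assms ksets_remove[of _ n k] unfolding realizable_iff
    by simp (smt (verit) Suc_eq_plus1 subset_iff)
qed

text \<open>An alternation of the contraction on the packet of \<open>X\<close> would be one of
  \<open>U\<close> on the packet of \<open>insert (Suc n) X\<close>, at the same three
  elements.\<close>

lemma realizable_contraction: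
  assumes "realizable (Suc n) (Suc k) U"
  shows "realizable n k {Z \<in> ksets n k. insert (Suc n) Z \<in> U}"
  unfolding realizable_iff_no_alternation
proof (intro conjI ballI impI)
  fix X a b c
  assume X: "X \<in> ksets n (k + 1)" and abc: "a \<in> X" "b \<in> X" "c \<in> X" "a < b" "b < c"
    and eq: "(X - {a} \<in> {Z \<in> ksets n k. insert (Suc n) Z \<in> U}) =
      (X - {c} \<in> {Z \<in> ksets n k. insert (Suc n) Z \<in> U})"
  have nX: "Suc n \<notin> X" using X by (auto simp: ksets_def)
  have X': "insert (Suc n) X \<in> ksets (Suc n) (Suc k + 1)"
    using X nX ksets_finite[OF X] by (auto simp: ksets_def)
  have rem: "insert (Suc n) X - {z} = insert (Suc n) (X - {z})" "X - {z} \<in> ksets n k"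
    if "z \<in> X" for z
    using that nX ksets_remove[OF X] by auto
  show "(X - {b} \<in> {Z \<in> ksets n k. insert (Suc n) Z \<in> U}) =
      (X - {a} \<in> {Z \<in> ksets n k. insert (Suc n) Z \<in> U})"
    using realizable_no_alternation[OF assms X', of a b c] abc eq rem by simp
qed auto

text \<open>With \<open>C\<close> the contraction of \<open>U\<close> by the maximal element \<open>m = n + 1\<close>, consistency on the packets of
  \<open>insert m Y\<close> makes \<open>C\<close> closed upwards for the relation of the deletion. All the edges between
  sets with and without \<open>m\<close> lead from outside \<open>C\<close> to sets containing \<open>m\<close>, or from these into \<open>C\<close>.\<close>

lemma linear_extension_exists:
  assumes "realizable n (k + 1) U"
  shows "\<exists>\<gamma>. set \<gamma> = ksets n k \<and> linear_extension (packet_rel n k U) \<gamma>"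
  using assms
proof (induction n arbitrary: k U)
  case 0
  have "packet_rel 0 k U = {}" by (auto simp: packet_rel_def ksets_def)
  moreover obtain \<gamma> where "set \<gamma> = ksets 0 k" "distinct \<gamma>"
    using finite_distinct_list[OF finite_ksets] by blast
  ultimately show ?case by (auto simp: linear_extension_def sorted_wrt_iff_nth_less)
next
  case (Suc n)
  let ?m = "Suc n"
  define D where "D = U \<inter> ksets n (k + 1)"
  define C where "C = {Z \<in> ksets n k. insert ?m Z \<in> U}"
  obtain \<delta> where \<delta>: "set \<delta> = ksets n k" "linear_extension (packet_rel n k D) \<delta>"
    using Suc.IH[of k D] realizable_deletion[OF Suc.prems] D_def by blast
  show ?case
  proof (cases k)
    \<comment> \<open>A packet of a singleton has only one member, so there are no edges. The
      contraction in the other case lowers \<open>k\<close>.\<close>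
    case 0
    have "packet_rel ?m k U = {}"
      by (auto simp: packet_rel_def ksets_def 0 card_1_singleton_iff)
    moreover obtain \<gamma> where "set \<gamma> = ksets ?m k" "distinct \<gamma>"
      using finite_distinct_list[OF finite_ksets] by blast
    ultimately show ?thesis by (auto simp: linear_extension_def sorted_wrt_iff_nth_less)
  next
    case (Suc k')
    have "realizable n (k' + 1) C"
      using realizable_contraction[of n k U] Suc.prems by (simp add: C_def Suc)
    then obtain \<epsilon> where \<epsilon>: "set \<epsilon> = ksets n k'" "linear_extension (packet_rel n k' C) \<epsilon>"
      using Suc.IH[of k' C] by blast
    have nm: "?m \<notin> Z" if "Z \<in> ksets n j" for Z j using that by (auto simp: ksets_def)
    have ksets_m: "Z \<in> ksets ?m j \<Longrightarrow> ?m \<notin> Z \<Longrightarrow> Z \<in> ksets n j" for Z j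
      by (auto simp: ksets_def atLeastAtMostSuc_conv)
    have ksets_m': "Z \<in> ksets ?m (Suc j) \<Longrightarrow> ?m \<in> Z \<Longrightarrow> Z - {?m} \<in> ksets n j" for Z j
      by (auto simp: ksets_def atLeastAtMostSuc_conv)
    have del: "(Y, Z) \<in> packet_rel n k D"
      if "(Y, Z) \<in> packet_rel ?m k U" "?m \<notin> Y" "?m \<notin> Z" for Y Z
    proof -
      from that(1) obtain X x y where *: "Y = X - {x}" "Z = X - {y}" "X \<in> ksets ?m (k + 1)"
        "x \<in> X" "y \<in> X" "x \<noteq> y" "if X \<in> U then x < y else y < x" by (rule packet_relE)
      then have "X \<in> ksets n (k + 1)" using that(2,3) ksets_m by auto
      then show ?thesis using * by (auto simp: D_def packet_rel_remove_iff)
    qed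
    have con: "(Y, Z) \<in> packet_rel n k' C"
      if "(insert ?m Y, insert ?m Z) \<in> packet_rel ?m k U" "?m \<notin> Y" "?m \<notin> Z" for Y Z
    proof -
      from that(1) obtain X x y where *: "insert ?m Y = X - {x}" "insert ?m Z = X - {y}"
        "X \<in> ksets ?m (k + 1)"
        "x \<in> X" "y \<in> X" "x \<noteq> y" "if X \<in> U then x < y else y < x" by (rule packet_relE)
      have mX: "?m \<in> X" "x \<noteq> ?m" "y \<noteq> ?m" using * by auto
      have "X - {?m} \<in> ksets n (k' + 1)" using ksets_m'[of X k] * mX Suc by simp
      moreover have "Y = (X - {?m}) - {x}" "Z = (X - {?m}) - {y}" using *(1,2) that(2,3) by auto
      moreover have "X - {?m} \<in> C \<longleftrightarrow> X \<in> U"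
        using calculation(1) mX by (simp add: C_def Suc insert_absorb)
      ultimately show ?thesis using * mX by (auto simp: packet_rel_remove_iff)
    qed
    have up: "Z \<in> C" if "(Y, Z) \<in> packet_rel ?m k U" "?m \<notin> Z" "Y \<in> C" for Y Z
    proof -
      have "(Y, Z) \<in> packet_rel n k D" using del[OF that(1) _ that(2)] that(3) nm C_def by auto
      then obtain X x y where *: "Y = X - {x}" "Z = X - {y}" "X \<in> ksets n (k + 1)"
        "x \<in> X" "y \<in> X" "x \<noteq> y" "if X \<in> D then x < y else y < x"
        by (rule packet_relE)
      have X': "insert ?m X \<in> ksets ?m (k + 1 + 1)"
        using * nm[OF *(3)] ksets_finite[OF *(3)] by (auto simp: ksets_def)
      have r: "insert ?m X - {z} = insert ?m (X - {z})" if "z \<in> X" for z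
        using that nm[OF *(3)] by auto
      have r': "insert ?m X - {?m} = X" using nm[OF *(3)] by auto
      have lt: "x < ?m" "y < ?m" using * by (auto simp: ksets_def)
      have "X \<in> D \<longleftrightarrow> X \<in> U" using * by (simp add: D_def)
      moreover have "insert ?m (X - {x}) \<in> U" using that(3) * by (simp add: C_def)
      \<comment> \<open>Removing the last element \<open>?m\<close> of \<open>insert ?m X\<close>
        gives \<open>X\<close>. If \<open>X \<in> U\<close>, then \<open>x < y < ?m\<close> and
        membership at both ends forces it at \<open>y\<close>. Otherwise \<open>y < x < ?m\<close>,
        and nonmembership at both ends would force it at \<open>x\<close>.\<close>
      ultimately have "insert ?m (X - {y}) \<in> U"
        using realizable_no_alternation[OF Suc.prems X', of x y ?m]
          realizable_no_alternation[OF Suc.prems X', of y x ?m] *(4-7) lt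
        by (auto simp: r r' split: if_splits)
      then show ?thesis using * ksets_remove[OF *(3)] by (simp add: C_def)
    qed
    have out: "Y \<notin> C" if "(Y, Z) \<in> packet_rel ?m k U" "?m \<in> Z" "?m \<notin> Y" for Y Z
    proof -
      from that(1) obtain X x y where *: "Y = X - {x}" "Z = X - {y}" "X \<in> ksets ?m (k + 1)"
        "x \<in> X" "y \<in> X" "x \<noteq> y" "if X \<in> U then x < y else y < x" by (rule packet_relE)
      then have "x = ?m" using that by auto
      \<comment> \<open>Since \<open>?m\<close> is maximal, an edge that starts by removing it has
        \<open>y < x\<close>, hence \<open>X \<notin> U\<close>; and \<open>X\<close> is
        \<open>insert ?m Y\<close>.\<close>
      moreover have "\<not> ?m < y" using * by (auto simp: ksets_def)
      ultimately show ?thesis using * by (auto simp: C_def insert_absorb)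
    qed
    have into: "Z \<in> C" if "(Y, Z) \<in> packet_rel ?m k U" "?m \<in> Y" "?m \<notin> Z" for Y Z
    proof -
      from that(1) obtain X x y where *: "Y = X - {x}" "Z = X - {y}" "X \<in> ksets ?m (k + 1)"
        "x \<in> X" "y \<in> X" "x \<noteq> y" "if X \<in> U then x < y else y < x" by (rule packet_relE)
      then have "y = ?m" using that by auto
      moreover have "\<not> ?m < x" using * by (auto simp: ksets_def)
      ultimately show ?thesis using * ksets_m'[of X k] by (auto simp: C_def insert_absorb split: if_splits)
    qed
    \<comment> \<open>The order of the three blocks is forced by \<open>into\<close> for the first
      two, by \<open>out\<close> for the last two, and by \<open>up\<close> for the outer
      ones.\<close>
    let ?\<gamma> = "filter (\<lambda>Z. Z \<notin> C) \<delta> @ map (insert ?m) \<epsilon> @ filter (\<lambda>Z. Z \<in> C) \<delta>"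
    have sup: "Z \<in> set ?\<gamma>" if "Z \<in> ksets ?m k" for Z
    proof (cases "?m \<in> Z")
      case True
      then have "Z = insert ?m (Z - {?m})" "Z - {?m} \<in> set \<epsilon>"
        using that ksets_m'[of Z k'] \<epsilon>(1) Suc by auto
      then show ?thesis by (metis Un_iff image_eqI set_append set_map)
    next
      case False
      then show ?thesis using ksets_m[OF that] \<delta>(1) by auto
    qed
    have "insert ?m Z \<in> ksets ?m k" if "Z \<in> ksets n k'" for Z
      using that nm[OF that] ksets_finite[OF that] Suc by (auto simp: ksets_def)
    moreover have "ksets n k \<subseteq> ksets ?m k" by (auto simp: ksets_def)
    ultimately have "set ?\<gamma> \<subseteq> ksets ?m k"
      using \<delta>(1) \<epsilon>(1) by auto
    then have "set ?\<gamma> = ksets ?m k" using sup by blast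
    moreover have "linear_extension (packet_rel ?m k U) ?\<gamma>"
      unfolding linear_extension_def
    proof
      have "inj_on (insert ?m) (ksets n k')"
        using nm by (intro inj_onI) (metis insert_ident)
      then show "distinct ?\<gamma>"
        using \<delta> \<epsilon> nm[of _ k] by (auto simp: linear_extension_def distinct_map)
      have 1: "sorted_wrt (\<lambda>Y Z. (Z, Y) \<notin> packet_rel ?m k U) \<delta>"
        using \<delta>(2) unfolding linear_extension_def
        by (elim conjE sorted_wrt_mono_rel[rotated]) (use del nm \<delta>(1) in blast)
      have 2: "sorted_wrt (\<lambda>Y Z. (insert ?m Z, insert ?m Y) \<notin> packet_rel ?m k U) \<epsilon>"
        using \<epsilon>(2) unfolding linear_extension_def
        by (elim conjE sorted_wrt_mono_rel[rotated]) (use con nm \<epsilon>(1) in blast)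
      show "sorted_wrt (\<lambda>Y Z. (Z, Y) \<notin> packet_rel ?m k U) ?\<gamma>"
        using 1 2 up out into nm \<delta>(1)
        by (fastforce simp: sorted_wrt_append sorted_wrt_map sorted_wrt_filter)
    qed
    ultimately show ?thesis by blast
  qed
qed

subsection \<open>Inversion sets of paths\<close>

text \<open>Elements not in \<open>\<gamma>\<close> get the position \<open>length \<gamma>\<close>, later than all others.\<close>

definition position :: "'a list \<Rightarrow> 'a \<Rightarrow> nat" where
  "position \<gamma> a = length (takeWhile (\<lambda>x. x \<noteq> a) \<gamma>)"

lemma position_le: "position \<gamma> a \<le> length \<gamma>"
  by (simp add: position_def length_takeWhile_le)

lemma position_less_iff: "position \<gamma> a < length \<gamma> \<longleftrightarrow> a \<in> set \<gamma>"
  by (induction \<gamma>) (auto simp: position_def)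

lemma nth_position: "a \<in> set \<gamma> \<Longrightarrow> \<gamma> ! position \<gamma> a = a"
  by (induction \<gamma>) (auto simp: position_def)

lemma position_inj:
  assumes "position \<gamma> a = position \<gamma> b" "position \<gamma> a < length \<gamma>"
  shows "a = b"
  using assms nth_position position_less_iff by metis

lemma mem_take_iff_position: "m \<le> length \<gamma> \<Longrightarrow> a \<in> set (take m \<gamma>) \<longleftrightarrow> position \<gamma> a < m"
proof (induction \<gamma> arbitrary: m)
  case (Cons c \<gamma>)
  then show ?case by (cases m) (auto simp: position_def)
qed (simp add: position_def)

lemma sorted_wrt_iff_position:
  "distinct \<gamma> \<Longrightarrow> sorted_wrt P \<gamma> \<longleftrightarrow>
    (\<forall>a\<in>set \<gamma>. \<forall>b\<in>set \<gamma>. position \<gamma> a < position \<gamma> b \<longrightarrow> P a b)"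
  by (induction \<gamma>) (auto simp: position_def)

lemma sorted_wrt_filter_iff:
  "sorted_wrt Q (filter P \<gamma>) \<longleftrightarrow> sorted_wrt (\<lambda>a b. P a \<longrightarrow> P b \<longrightarrow> Q a b) \<gamma>"
  by (induction \<gamma>) auto

text \<open>Here \<open>t x\<close> is the time at which \<open>x\<close> enters a growing set, with
  \<open>L\<close> for never, so ties occur only at \<open>L\<close>. For \<open>a < b < c\<close>,
  if \<open>t b\<close> were strictly below both \<open>t a\<close> and \<open>t c\<close>, the
  stage \<open>t b + 1\<close> would alternate; if strictly above both, the stage \<open>t b\<close>
  would. So \<open>t b\<close> lies between them, which excludes a rise together with a
  descent.\<close>

lemma monotone_or_antitone:
  fixes X :: "'a::linorder set" and t :: "'a \<Rightarrow> nat"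
  assumes closed: "\<And>m. m \<le> L \<Longrightarrow> (\<forall>x\<in>X. \<forall>y\<in>X. x < y \<longrightarrow> t x < m \<longrightarrow> t y < m) \<or>
      (\<forall>x\<in>X. \<forall>y\<in>X. x < y \<longrightarrow> t y < m \<longrightarrow> t x < m)"
    and le: "\<And>x. x \<in> X \<Longrightarrow> t x \<le> L"
    and inj: "\<And>x y. x \<in> X \<Longrightarrow> y \<in> X \<Longrightarrow> t x = t y \<Longrightarrow> t x < L \<Longrightarrow> x = y"
  shows "(\<forall>x\<in>X. \<forall>y\<in>X. x < y \<longrightarrow> t x \<le> t y) \<or> (\<forall>x\<in>X. \<forall>y\<in>X. x < y \<longrightarrow> t y \<le> t x)"
proof -
  have between: "(t a \<le> t b \<and> t b \<le> t c) \<or> (t c \<le> t b \<and> t b \<le> t a)"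
    if "a \<in> X" "b \<in> X" "c \<in> X" "a < b" "b < c" for a b c
  proof (rule ccontr)
    assume neg: "\<not> ?thesis"
    show False
    proof (cases "t b < t a")
      case True
      then have "t b < t c" using neg by linarith
      then have "\<not> t a < t b + 1" "\<not> t c < t b + 1" "t b < t b + 1" using True by linarith+
      moreover have "t b + 1 \<le> L" using True le[OF that(1)] by linarith
      ultimately show False using closed[of "t b + 1"] that by blast
    next
      case False
      then have "t a < t b" "t c < t b" using neg by linarith+
      then show False using closed[of "t b"] le that by blast
    qed
  qed
  show ?thesis
  proof (rule ccontr)
    assume "\<not> ?thesis"
    then obtain x y u v where *: "x \<in> X" "y \<in> X" "u \<in> X" "v \<in> X" "x < y" "u < v"
      "t x < t y" "t v < t u" by (metis not_le)
    then show False using between le inj by (smt (verit) linorder_neqE order.strict_trans le_less leD)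
  qed
qed

lemma realizable_paths_position:
  assumes "\<gamma> \<in> paths n k J" "m \<le> length \<gamma>"
  shows "realizable n k {a. position \<gamma> a < m}"
proof -
  have "realizable n k (set (take m \<gamma>))"
    using assms(1) take_is_prefix by (auto simp: paths_def)
  moreover have "set (take m \<gamma>) = {a. position \<gamma> a < m}"
    using mem_take_iff_position[OF assms(2)] by blast
  ultimately show ?thesis by simp
qed

text \<open>Every stage of the path is realizable. Packets only partly in \<open>J\<close> are
  covered too, because missing sets have the last position.\<close>

lemma path_monotone_or_antitone:
  assumes "\<gamma> \<in> paths n k J" "X \<in> ksets n (k + 1)"
  shows "(\<forall>x\<in>X. \<forall>y\<in>X. x < y \<longrightarrow> position \<gamma> (X - {x}) \<le> position \<gamma> (X - {y})) \<or>
    (\<forall>x\<in>X. \<forall>y\<in>X. x < y \<longrightarrow> position \<gamma> (X - {y}) \<le> position \<gamma> (X - {x}))"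
proof (rule monotone_or_antitone[where L = "length \<gamma>"])
  fix m assume "m \<le> length \<gamma>"
  then show "(\<forall>x\<in>X. \<forall>y\<in>X. x < y \<longrightarrow> position \<gamma> (X - {x}) < m \<longrightarrow> position \<gamma> (X - {y}) < m) \<or>
      (\<forall>x\<in>X. \<forall>y\<in>X. x < y \<longrightarrow> position \<gamma> (X - {y}) < m \<longrightarrow> position \<gamma> (X - {x}) < m)"
    using realizable_paths_position[OF assms(1)] assms(2) by (simp add: realizable_iff)
qed (use position_le position_inj remove_eq_iff in \<open>metis+\<close>)

lemma sorted_antilex_iff:
  assumes "distinct \<gamma>" "X \<in> ksets n (k + 1)" "packet n k X \<subseteq> set \<gamma>"
  shows "sorted_wrt (\<lambda>Y Z. lex_less Z Y) (filter (\<lambda>Y. Y \<in> packet n k X) \<gamma>) \<longleftrightarrow>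
    (\<forall>x\<in>X. \<forall>y\<in>X. position \<gamma> (X - {x}) < position \<gamma> (X - {y}) \<longrightarrow> x < y)"
proof -
  have "sorted_wrt (\<lambda>Y Z. lex_less Z Y) (filter (\<lambda>Y. Y \<in> packet n k X) \<gamma>) \<longleftrightarrow>
    (\<forall>Y\<in>packet n k X. \<forall>Z\<in>packet n k X. position \<gamma> Y < position \<gamma> Z \<longrightarrow> lex_less Z Y)"
    unfolding sorted_wrt_filter_iff sorted_wrt_iff_position[OF assms(1)]
    using assms(3) by blast
  then show ?thesis
    using lex_less_remove_iff[OF ksets_finite[OF assms(2)]]
    by (simp add: packet_eq[OF assms(2)])
qed

lemma ksets_two_elements:
  assumes "X \<in> ksets n (k + 1)" "0 < k"
  obtains x y where "x \<in> X" "y \<in> X" "x < y"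
proof -
  have "\<not> card X \<le> Suc 0" using assms by (simp add: ksets_def)
  then obtain x y where "x \<in> X" "y \<in> X" "x \<noteq> y"
    using card_le_Suc0_iff_eq[OF ksets_finite[OF assms(1)]] by blast
  then show thesis using that[of x y] that[of y x] by (cases "x < y") auto
qed

text \<open>Missing sets come last, so a packet of \<open>J\<^sub>s\<close> also looks
  antilexicographic, and both parts of \<open>Inv\<close> get one description. A single pair
  decides, because positions are monotone or antitone on the packet. With \<open>0 < k\<close> every
  packet has such a pair.\<close>

lemma Inv_iff:
  assumes \<gamma>: "\<gamma> \<in> paths n k J" and k: "0 < k"
  shows "X \<in> Inv n k \<gamma> \<longleftrightarrow> X \<in> ksets n (k + 1) \<and>
    (\<exists>x\<in>X. \<exists>y\<in>X. x < y \<and> position \<gamma> (X - {x}) < position \<gamma> (X - {y}))"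
proof (cases "X \<in> ksets n (k + 1)")
  case False
  then show ?thesis by (auto simp: Inv_def suffix_part_def full_part_def)
next
  case X: True
  have d: "distinct \<gamma>" using \<gamma> by (simp add: paths_def)
  show ?thesis
  proof
    assume "X \<in> Inv n k \<gamma>"
    then consider "X \<in> suffix_part n k (set \<gamma>)"
      | "packet n k X \<subseteq> set \<gamma>"
        "sorted_wrt (\<lambda>Y Z. lex_less Z Y) (filter (\<lambda>Y. Y \<in> packet n k X) \<gamma>)"
      by (auto simp: Inv_def full_part_def)
    then have "\<exists>x\<in>X. \<exists>y\<in>X. x < y \<and> position \<gamma> (X - {x}) < position \<gamma> (X - {y})"
    proof cases
      case 1
      then have closed: "\<And>x y. x \<in> X \<Longrightarrow> y \<in> X \<Longrightarrow> x < y \<Longrightarrow> X - {y} \<in> set \<gamma> \<Longrightarrow> X - {x} \<in> set \<gamma>"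
        using lex_suffix_packet_iff[OF X] by (auto simp: suffix_part_def)
      from 1 obtain x y where "x \<in> X" "X - {x} \<in> set \<gamma>" "y \<in> X" "X - {y} \<notin> set \<gamma>"
        by (auto simp: suffix_part_def packet_eq[OF X])
      moreover from this have "x < y" using closed by (metis linorder_neqE_nat)
      ultimately show ?thesis using position_less_iff by (metis le_less_linear order_less_le_trans)
    next
      case 2
      obtain x y where "x \<in> X" "y \<in> X" "x < y" using ksets_two_elements[OF X k] .
      moreover from this have "position \<gamma> (X - {x}) \<noteq> position \<gamma> (X - {y})"
        using 2(1) position_inj[of \<gamma> "X - {x}" "X - {y}"] position_less_iff[of \<gamma> "X - {x}"]
        by (auto simp: packet_eq[OF X])
      ultimately show ?thesis
        using 2(2) unfolding sorted_antilex_iff[OF d X 2(1)] by (metis linorder_neqE_nat less_asym)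
    qed
    then show "X \<in> ksets n (k + 1) \<and>
        (\<exists>x\<in>X. \<exists>y\<in>X. x < y \<and> position \<gamma> (X - {x}) < position \<gamma> (X - {y}))" using X by blast
  next
    assume "X \<in> ksets n (k + 1) \<and>
        (\<exists>x\<in>X. \<exists>y\<in>X. x < y \<and> position \<gamma> (X - {x}) < position \<gamma> (X - {y}))"
    then obtain a b where ab: "a \<in> X" "b \<in> X" "a < b"
      "position \<gamma> (X - {a}) < position \<gamma> (X - {b})" by blast
    then have mono: "\<And>x y. x \<in> X \<Longrightarrow> y \<in> X \<Longrightarrow> x < y \<Longrightarrow>
        position \<gamma> (X - {x}) \<le> position \<gamma> (X - {y})"
      using path_monotone_or_antitone[OF \<gamma> X] by (meson leD)
    show "X \<in> Inv n k \<gamma>"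
    proof (cases "packet n k X \<subseteq> set \<gamma>")
      case True
      then have "sorted_wrt (\<lambda>Y Z. lex_less Z Y) (filter (\<lambda>Y. Y \<in> packet n k X) \<gamma>)"
        unfolding sorted_antilex_iff[OF d X True]
      proof (intro ballI impI)
        fix x y assume "x \<in> X" "y \<in> X" "position \<gamma> (X - {x}) < position \<gamma> (X - {y})"
        then show "x < y" using mono[of y x] by (cases x y rule: linorder_cases) auto
      qed
      then show ?thesis using True X by (auto simp: Inv_def full_part_def)
    next
      case False
      have "lex_suffix (packet n k X \<inter> set \<gamma>) (packet n k X)"
        unfolding lex_suffix_packet_iff[OF X]
        using mono position_less_iff by (metis order_le_less_trans)
      moreover have "X - {a} \<in> packet n k X \<inter> set \<gamma>"
        using ab position_le position_less_iff packet_eq[OF X]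
        by (metis IntI image_eqI order_less_le_trans)
      ultimately show ?thesis using X False by (auto simp: Inv_def suffix_part_def)
    qed
  qed
qed

lemma Inv_bounds:
  assumes "\<gamma> \<in> paths n k J"
  shows "suffix_part n k J \<subseteq> Inv n k \<gamma>" "Inv n k \<gamma> \<subseteq> suffix_part n k J \<union> full_part n k J"
  using assms by (auto simp: Inv_def paths_def)

text \<open>The inequality is weak because all sets outside \<open>J\<close> share the last
  position.\<close>

lemma path_position_mono:
  assumes "\<gamma> \<in> paths n k J" "0 < k" "(Y, Z) \<in> packet_rel n k (Inv n k \<gamma>)"
  shows "position \<gamma> Y \<le> position \<gamma> Z"
  using assms(3)
proof (rule packet_relE)
  fix X x y
  assume *: "Y = X - {x}" "Z = X - {y}" "X \<in> ksets n (k + 1)" "x \<in> X" "y \<in> X" "x \<noteq> y"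
    "if X \<in> Inv n k \<gamma> then x < y else y < x"
  then show ?thesis
    using Inv_iff[OF assms(1,2), of X] path_monotone_or_antitone[OF assms(1), of X]
    by (cases "X \<in> Inv n k \<gamma>") (simp, meson leD not_le)+
qed

lemma path_linear_extension:
  assumes "\<gamma> \<in> paths n k J" "0 < k"
  shows "linear_extension (packet_rel n k (Inv n k \<gamma>)) \<gamma>"
  using path_position_mono[OF assms] assms(1) sorted_wrt_iff_position[of \<gamma>]
  by (fastforce simp: linear_extension_def paths_def)

text \<open>For an alternating triple \<open>a < b < c\<close> in a \<open>(k+2)\<close>-set \<open>X\<close>, the three packets force the sets \<open>X\<close>
  minus two of \<open>a, b, c\<close> to have equal positions, so all three lie outside \<open>J\<close>. Some \<open>j < a\<close> then
  yields an alternation of \<open>J\<close> itself on the packet of \<open>X - {j}\<close>.\<close>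

lemma Inv_realizable:
  assumes \<gamma>: "\<gamma> \<in> paths n k J" and k: "0 < k"
  shows "realizable n (k + 1) (Inv n k \<gamma>)"
  unfolding realizable_iff_no_alternation
proof (intro conjI ballI impI)
  show "Inv n k \<gamma> \<subseteq> ksets n (k + 1)" using Inv_iff[OF assms] by blast
next
  fix X a b c
  assume X: "X \<in> ksets n (k + 1 + 1)" and abc: "a \<in> X" "b \<in> X" "c \<in> X" "a < b" "b < c"
    and eq: "(X - {a} \<in> Inv n k \<gamma>) = (X - {c} \<in> Inv n k \<gamma>)"
  \<comment> \<open>Row \<open>i\<close> of the symmetric table \<open>T\<close> holds the positions
    along the packet of \<open>X - {i}\<close>. Off the diagonal it weakly increases if
    \<open>I i\<close> holds (\<open>I_mono\<close>) and weakly decreases otherwise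
    (\<open>O_anti\<close>).\<close>
  define T where "T i j = position \<gamma> (X - {i} - {j})" for i j
  define L where "L = length \<gamma>"
  define I where "I i \<longleftrightarrow> X - {i} \<in> Inv n k \<gamma>" for i
  have sym: "T i j = T j i" for i j by (simp add: T_def Diff_insert2[symmetric] insert_commute)
  have le: "T i j \<le> L" for i j by (simp add: T_def L_def position_le)
  have Xi: "X - {i} \<in> ksets n (k + 1)" if "i \<in> X" for i using ksets_remove[OF X that] .
  have I_mono: "T i j \<le> T i j'" if "I i" "i \<in> X" "j \<in> X" "j' \<in> X" "j \<noteq> i" "j' \<noteq> i" "j \<le> j'" for i j j'
    using path_position_mono[OF assms packet_relI[OF Xi, of i j j']] that
    by (cases "j = j'") (auto simp: I_def T_def)
  have O_anti: "T i j' \<le> T i j" if "\<not> I i" "i \<in> X" "j \<in> X" "j' \<in> X" "j \<noteq> i" "j' \<noteq> i" "j \<le> j'" for i j j'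
    using path_position_mono[OF assms packet_relI[OF Xi, of i j' j]] that
    by (cases "j = j'") (auto simp: I_def T_def)
  have I_ex: "\<exists>j\<in>X. j \<noteq> i \<and> T i j < L" if "I i" for i
    using that Inv_iff[OF assms, of "X - {i}"] le unfolding I_def T_def[symmetric]
    by (metis DiffE order_less_le_trans singletonI)
  \<comment> \<open>The last stage of the path is \<open>J\<close>, so this is the realizability of
    \<open>J\<close> on the packet of \<open>X - {i}\<close>.\<close>
  have no_alt: "(T i a < L) \<noteq> (T i c < L) \<or> (T i b < L) = (T i a < L)" if "i \<in> X" "i < a" for i
  proof -
    have "realizable n k {Y. position \<gamma> Y < L}"
      using realizable_paths_position[OF \<gamma>] by (simp add: L_def)
    from realizable_no_alternation[OF this Xi[OF that(1)], of a b c]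
    show ?thesis using abc that(2) by (auto simp: T_def)
  qed
  have all_L: "T a b = L \<and> T b c = L \<and> T a c = L" if "T a b = T b c" "T b c = T a c"
  proof -
    have "c \<in> X - {a} - {b}" "c \<notin> X - {b} - {c}" using abc by auto
    then have "X - {a} - {b} \<noteq> X - {b} - {c}" by metis
    then have "\<not> T a b < L"
      using position_inj[of \<gamma> "X - {a} - {b}" "X - {b} - {c}"] that(1) by (auto simp: T_def L_def)
    then show ?thesis using that le[of a b] by simp
  qed
  have "I b = I a" if ac: "I a = I c"
  proof (rule ccontr)
    assume b: "I b \<noteq> I a"
    show False
    proof (cases "I a")
      case False
      have "T a c \<le> T a b" using O_anti[of a b c] False abc by auto
      moreover have "T a b \<le> T b c" using I_mono[of b a c] False b abc sym[of a b] by auto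
      moreover have "T b c \<le> T a c"
        using O_anti[of c a b] False ac abc sym[of a c] sym[of b c] by auto
      ultimately have L: "T a b = L" "T b c = L" "T a c = L" using all_L by linarith+
      \<comment> \<open>Row \<open>b\<close> increases and has the value \<open>L\<close> at
        \<open>a\<close>, so an entry below \<open>L\<close> must come before \<open>a\<close>. Rows
        \<open>a\<close> and \<open>c\<close> decrease and equal \<open>L\<close> at this
        \<open>j\<close>, so row \<open>j\<close> alternates.\<close>
      obtain j where j: "j \<in> X" "j \<noteq> b" "T b j < L" using I_ex[of b] b False by blast
      then have "j < a" using I_mono[of b a j] L b False abc sym[of a b] by (cases "a \<le> j") auto
      have "T j a = L"
        using O_anti[of a j b] L False abc j \<open>j < a\<close> le[of a j] sym[of a j] by auto
      moreover have "T j c = L"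
        using O_anti[of c j a] L False ac abc j \<open>j < a\<close> le[of c j] sym[of c j] sym[of a c] by auto
      moreover have "T j b < L" using j(3) sym[of b j] by simp
      ultimately show False using no_alt[OF j(1) \<open>j < a\<close>] by simp
    next
      case True
      have "T a b \<le> T a c" using I_mono[of a b c] True abc by auto
      moreover have "T b c \<le> T a b" using O_anti[of b a c] True b abc sym[of a b] by auto
      moreover have "T a c \<le> T b c"
        using I_mono[of c a b] True ac abc sym[of a c] sym[of b c] by auto
      ultimately have L: "T a b = L" "T b c = L" "T a c = L" using all_L by linarith+
      obtain j where j: "j \<in> X" "j \<noteq> a" "T a j < L" using I_ex[of a] True by blast
      obtain i where i: "i \<in> X" "i \<noteq> c" "T c i < L" using I_ex[of c] True ac by blast
      have ib: "i < a" using I_mono[of c a i] L True ac abc i sym[of a c] by force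
      \<comment> \<open>Rows \<open>a\<close> and \<open>c\<close> increase, so the smaller witness
        has an entry below \<open>L\<close> in both. Row \<open>b\<close> decreases to
        \<open>L\<close> at \<open>a\<close> and so equals \<open>L\<close> at
        \<open>h\<close>.\<close>
      define h where "h = min i j"
      have h: "h \<in> X" "h < a" using i j ib by (auto simp: h_def min_def)
      have "T a h < L" using I_mono[of a h j] h True abc j by (force simp: h_def)
      moreover have "T c h < L" using I_mono[of c h i] h True ac abc i by (force simp: h_def)
      moreover have "T b h = L" using O_anti[of b h a] h True b abc L le[of b h] sym[of a b] by force
      ultimately show False using no_alt[OF h] sym by simp
    qed
  qed
  then show "(X - {b} \<in> Inv n k \<gamma>) = (X - {a} \<in> Inv n k \<gamma>)" using eq by (simp add: I_def)
qed

lemma Inv_in_inversion_sets: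
  assumes "\<gamma> \<in> paths n k J" "0 < k"
  shows "Inv n k \<gamma> \<in> inversion_sets n k J"
  using Inv_realizable[OF assms] Inv_bounds[OF assms(1)] by (simp add: inversion_sets_def)

text \<open>As \<open>J\<close> is a down-set of the relation, so is every prefix of a linear
  extension on \<open>J\<close>, and down-sets are realizable.\<close>

lemma linear_extension_path:
  assumes J: "realizable n k J"
    and U: "suffix_part n k J \<subseteq> U" "U \<subseteq> suffix_part n k J \<union> full_part n k J"
    and \<gamma>: "linear_extension (packet_rel n k U) \<gamma>" "set \<gamma> = J"
  shows "\<gamma> \<in> paths n k J"
proof -
  have "realizable n k (set xs)" if pre: "prefix xs \<gamma>" for xs
  proof (rule realizable_if_packet_rel_closed)
    obtain ys where ys: "\<gamma> = xs @ ys" using pre by (auto simp: prefix_def)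
    show "set xs \<subseteq> ksets n k" using J \<gamma>(2) ys by (auto simp: realizable_def)
    fix Y Z assume YZ: "(Y, Z) \<in> packet_rel n k U" "Z \<in> set xs"
    then have "Y \<in> J" using packet_rel_closed[OF J U] \<gamma>(2) ys by auto
    then show "Y \<in> set xs"
      using YZ \<gamma> ys by (auto simp: linear_extension_def sorted_wrt_append)
  qed
  then show ?thesis using \<gamma> by (simp add: paths_def linear_extension_def)
qed

text \<open>Positions weakly increase along all edges, also those leaving \<open>J\<close>. A strict
  rise on a packet therefore forces \<open>X \<in> U\<close>; conversely the members of a full
  packet have distinct positions, so if \<open>X \<in> U\<close> a strict rise occurs.\<close>

lemma linear_extension_Inv:
  assumes J: "realizable n k J" and k: "0 < k"
    and U: "suffix_part n k J \<subseteq> U" "U \<subseteq> suffix_part n k J \<union> full_part n k J"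
    and \<gamma>: "linear_extension (packet_rel n k U) \<gamma>" "set \<gamma> = J"
  shows "Inv n k \<gamma> = U"
proof -
  have path: "\<gamma> \<in> paths n k J" using linear_extension_path[OF assms(1,3-6)] .
  have before: "position \<gamma> Y \<le> position \<gamma> Z" if "(Y, Z) \<in> packet_rel n k U" for Y Z
  proof (cases "Z \<in> J")
    case True
    then have "Y \<in> J" using packet_rel_closed[OF J U that] by simp
    then have "\<not> position \<gamma> Z < position \<gamma> Y"
      using True that \<gamma> sorted_wrt_iff_position[of \<gamma> "\<lambda>x y. (y, x) \<notin> packet_rel n k U"]
      by (auto simp: linear_extension_def)
    then show ?thesis by simp
  next
    case False
    then have "position \<gamma> Z = length \<gamma>"
      using \<gamma>(2) position_less_iff[of \<gamma> Z] position_le[of \<gamma> Z] by auto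
    then show ?thesis using position_le by simp
  qed
  show ?thesis
  proof (intro equalityI subsetI)
    fix X assume "X \<in> Inv n k \<gamma>"
    then obtain x y where *: "X \<in> ksets n (k + 1)" "x \<in> X" "y \<in> X" "x < y"
      "position \<gamma> (X - {x}) < position \<gamma> (X - {y})" using Inv_iff[OF path k] by blast
    then show "X \<in> U"
      using before[of "X - {y}" "X - {x}"] packet_rel_remove_iff[OF *(1,3,2), of U]
      by (auto split: if_splits)
  next
    fix X assume XU: "X \<in> U"
    show "X \<in> Inv n k \<gamma>"
    proof (cases "X \<in> suffix_part n k J")
      case True
      then show ?thesis using Inv_bounds(1)[OF path] by blast
    next
      case False
      then have X: "X \<in> ksets n (k + 1)" "packet n k X \<subseteq> J"
        using XU U(2) by (auto simp: full_part_def)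
      obtain x y where xy: "x \<in> X" "y \<in> X" "x < y" using ksets_two_elements[OF X(1) k] .
      then have "X - {x} \<in> set \<gamma>" "X - {x} \<noteq> X - {y}" using X \<gamma>(2) by (auto simp: packet_eq)
      then have "position \<gamma> (X - {x}) \<noteq> position \<gamma> (X - {y})"
        using position_inj position_less_iff by metis
      moreover have "position \<gamma> (X - {x}) \<le> position \<gamma> (X - {y})"
        using before packet_rel_remove_iff[OF X(1) xy(1,2)] XU xy by simp
      ultimately show ?thesis using X xy unfolding Inv_iff[OF path k] by force
    qed
  qed
qed

subsection \<open>Injectivity and surjectivity\<close>

text \<open>Sorting by adjacent swaps: every element before the head \<open>x\<close> of the target
  comes after \<open>x\<close> in the target, so it is incomparable to \<open>x\<close>. Hence
  \<open>x\<close> can be moved to the front, and induction treats the tail.\<close>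

lemma linear_extensions_connected:
  fixes R :: "'a rel"
  defines "swap \<equiv> \<lambda>\<gamma> \<gamma>'. linear_extension R \<gamma> \<and> linear_extension R \<gamma>' \<and>
    (\<exists>us a b vs. \<gamma> = us @ [a, b] @ vs \<and> \<gamma>' = us @ [b, a] @ vs \<and> (a, b) \<notin> R \<and> (b, a) \<notin> R)"
  assumes "linear_extension R \<gamma>" "linear_extension R \<gamma>'" "set \<gamma> = set \<gamma>'"
  shows "swap\<^sup>*\<^sup>* \<gamma> \<gamma>'"
  using assms(2-)
proof (induction \<gamma>' arbitrary: \<gamma>)
  case Nil
  then show ?case by simp
next
  case (Cons x \<gamma>')
  have move: "swap\<^sup>*\<^sup>* (us @ x # vs) (x # us @ vs)"
    if "linear_extension R (us @ x # vs)" "\<forall>u\<in>set us. (x, u) \<notin> R \<and> (u, x) \<notin> R" for us vs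
    using that
  proof (induction us arbitrary: vs rule: rev_induct)
    case (snoc u us)
    have le: "linear_extension R (us @ x # u # vs)"
      using snoc.prems by (auto simp: linear_extension_def sorted_wrt_append)
    then have "swap ((us @ [u]) @ x # vs) (us @ x # u # vs)"
      using snoc.prems unfolding swap_def by auto
    moreover have "swap\<^sup>*\<^sup>* (us @ x # u # vs) (x # us @ u # vs)"
      using snoc.IH[OF le] snoc.prems(2) by simp
    ultimately show ?case by (simp add: converse_rtranclp_into_rtranclp)
  qed simp
  have "x \<in> set \<gamma>" using Cons.prems(3) by simp
  then obtain us vs where \<gamma>: "\<gamma> = us @ x # vs" by (meson split_list)
  have ux: "\<forall>u\<in>set us. (x, u) \<notin> R \<and> (u, x) \<notin> R"
  proof
    fix u assume u: "u \<in> set us"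
    then have "u \<noteq> x" using Cons.prems(1) \<gamma> by (auto simp: linear_extension_def)
    then have "u \<in> set \<gamma>'" using u \<gamma> Cons.prems(3) by auto
    then show "(x, u) \<notin> R \<and> (u, x) \<notin> R"
      using u Cons.prems(1,2) \<gamma> by (auto simp: linear_extension_def sorted_wrt_append)
  qed
  have le: "linear_extension R (us @ vs)" "linear_extension R \<gamma>'"
    using Cons.prems(1,2) \<gamma> by (auto simp: linear_extension_def sorted_wrt_append)
  have sets: "set (us @ vs) = set \<gamma>'"
    using Cons.prems \<gamma> by (auto simp: linear_extension_def)
  have "swap\<^sup>*\<^sup>* (us @ vs) \<gamma>'" using Cons.IH[OF le sets] .
  \<comment> \<open>The set equation is carried along so that \<open>x\<close> can be put in front
    of every intermediate list: no edge leads from these elements to \<open>x\<close>.\<close>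
  then have "set \<gamma>' = set (us @ vs) \<and> swap\<^sup>*\<^sup>* (x # us @ vs) (x # \<gamma>')"
  proof (induction rule: rtranclp_induct)
    case (step y z)
    have "set z = set y" using step.hyps(2) by (auto simp: swap_def)
    have "linear_extension R (x # w)" if "linear_extension R w" "set w = set (us @ vs)" for w
      using that Cons.prems(2) sets by (auto simp: linear_extension_def)
    then have "linear_extension R (x # y)" "linear_extension R (x # z)"
      using step.hyps(2) step.IH \<open>set z = set y\<close> by (auto simp: swap_def)
    moreover obtain ws a b xs where
      "y = ws @ [a, b] @ xs" "z = ws @ [b, a] @ xs" "(a, b) \<notin> R" "(b, a) \<notin> R"
      using step.hyps(2) by (auto simp: swap_def)
    then have "x # y = (x # ws) @ [a, b] @ xs" "x # z = (x # ws) @ [b, a] @ xs"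
      "(a, b) \<notin> R" "(b, a) \<notin> R" by simp_all
    ultimately have "swap (x # y) (x # z)" unfolding swap_def by blast
    then show ?case using step.IH \<open>set z = set y\<close> by (auto intro: rtranclp.rtrancl_into_rtrancl)
  qed simp
  moreover have "swap\<^sup>*\<^sup>* \<gamma> (x # us @ vs)" using move[of us vs] Cons.prems(1) \<gamma> ux by simp
  ultimately show ?case by (meson rtranclp_trans)
qed

text \<open>Both paths are linear extensions of one relation. Each packet is a chain, so
  incomparable neighbours share no packet and their swap is an elementary equivalence.\<close>

lemma path_equiv_if_Inv_eq:
  assumes J: "realizable n k J" and k: "0 < k"
    and \<gamma>: "\<gamma> \<in> paths n k J" "\<gamma>' \<in> paths n k J" and eq: "Inv n k \<gamma> = Inv n k \<gamma>'"
  shows "(\<gamma>, \<gamma>') \<in> path_equiv n k J"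
proof -
  let ?R = "packet_rel n k (Inv n k \<gamma>)"
  let ?swap = "\<lambda>\<gamma> \<gamma>'. linear_extension ?R \<gamma> \<and> linear_extension ?R \<gamma>' \<and>
    (\<exists>us a b vs. \<gamma> = us @ [a, b] @ vs \<and> \<gamma>' = us @ [b, a] @ vs \<and> (a, b) \<notin> ?R \<and> (b, a) \<notin> ?R)"
  have sets: "set \<gamma> = J" "set \<gamma>' = J" using \<gamma> by (auto simp: paths_def)
  have swap_equiv: "elem_equiv n k J y z" if swap: "?swap y z" and y: "set y = J" for y z
  proof -
    obtain us a b vs where *: "y = us @ [a, b] @ vs" "z = us @ [b, a] @ vs"
      "(a, b) \<notin> ?R" "(b, a) \<notin> ?R" using swap by blast
    have "set z = J" using * y by auto
    then have "y \<in> paths n k J" "z \<in> paths n k J"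
      using linear_extension_path[OF J Inv_bounds[OF \<gamma>(1)]] swap y by blast+
    moreover have "a \<noteq> b" using swap * by (auto simp: linear_extension_def)
    then have "\<not> (\<exists>X \<in> ksets n (k + 1). a \<in> packet n k X \<and> b \<in> packet n k X)"
      using *(3,4) by (auto simp: packet_eq packet_rel_remove_iff split: if_splits)
    ultimately show ?thesis using * unfolding elem_equiv_def by blast
  qed
  have "?swap\<^sup>*\<^sup>* \<gamma> \<gamma>'"
    using linear_extensions_connected[of ?R \<gamma> \<gamma>'] path_linear_extension[OF \<gamma>(1) k]
      path_linear_extension[OF \<gamma>(2) k] sets eq by simp
  then have "set \<gamma>' = J \<and> equivclp (elem_equiv n k J) \<gamma> \<gamma>'"
  proof (induction rule: rtranclp_induct)
    case base
    then show ?case using sets by simp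
  next
    case (step y z)
    then have e: "elem_equiv n k J y z" using swap_equiv by blast
    then have "set z = J" by (auto simp: elem_equiv_def paths_def)
    then show ?case using step.IH e by (meson equivclp_trans r_into_equivclp)
  qed
  then show ?thesis using \<gamma> by (simp add: path_equiv_def)
qed

lemma restrict_linear_extension:
  assumes "linear_extension R \<gamma>"
  shows "linear_extension R (filter P \<gamma>)"
  using assms by (auto simp: linear_extension_def sorted_wrt_filter)

text \<open>Acyclicity is available on all \<open>k\<close>-sets; the path is the restriction of a
  global linear extension to \<open>J\<close>.\<close>

lemma path_exists:
  assumes J: "realizable n k J" and k: "0 < k" and U: "U \<in> inversion_sets n k J"
  obtains \<gamma> where "\<gamma> \<in> paths n k J" "Inv n k \<gamma> = U"
proof -
  obtain \<delta> where \<delta>: "set \<delta> = ksets n k" "linear_extension (packet_rel n k U) \<delta>"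
    using linear_extension_exists[of n k U] U by (auto simp: inversion_sets_def)
  let ?\<gamma> = "filter (\<lambda>Z. Z \<in> J) \<delta>"
  have "set ?\<gamma> = J" using \<delta>(1) J by (auto simp: realizable_def)
  then show thesis
    using that[of ?\<gamma>] restrict_linear_extension[OF \<delta>(2)] U
      linear_extension_path[OF J, of U ?\<gamma>] linear_extension_Inv[OF J k, of U ?\<gamma>]
    by (simp add: inversion_sets_def)
qed

subsection \<open>Packet flips\<close>

lemma linear_extension_position_less:
  assumes "linear_extension (packet_rel n k U) \<gamma>" "set \<gamma> = ksets n k"
    "(Y, Z) \<in> packet_rel n k U"
  shows "position \<gamma> Y < position \<gamma> Z"
  using assms(3)
proof (rule packet_relE)
  fix X x y
  assume *: "Y = X - {x}" "Z = X - {y}" "X \<in> ksets n (k + 1)" "x \<in> X" "y \<in> X" "x \<noteq> y"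
  then have mem: "Y \<in> set \<gamma>" "Z \<in> set \<gamma>" "Y \<noteq> Z" using assms(2) ksets_remove by auto
  then have "\<not> position \<gamma> Z < position \<gamma> Y"
    using assms(1,3) sorted_wrt_iff_position[of \<gamma> "\<lambda>x y. (y, x) \<notin> packet_rel n k U"]
    by (auto simp: linear_extension_def)
  moreover have "position \<gamma> Y \<noteq> position \<gamma> Z"
    using mem position_inj position_less_iff by metis
  ultimately show ?thesis by simp
qed

text \<open>Only the packet of \<open>X\<close> is reoriented, and a pair of its distinct members
  lies in no other packet.\<close>

lemma packet_rel_insert_iff:
  assumes X: "X \<in> ksets n (k + 1)" "X \<notin> U"
  shows "(Y, Z) \<in> packet_rel n k (insert X U) \<longleftrightarrow>
    (if Y \<in> packet n k X \<and> Z \<in> packet n k X then (Z, Y) \<in> packet_rel n k U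
     else (Y, Z) \<in> packet_rel n k U)"
proof (cases "Y \<in> packet n k X \<and> Z \<in> packet n k X")
  case True
  then show ?thesis
    using X(2) by (auto simp: packet_eq[OF X(1)] packet_rel_remove_iff[OF X(1)])
next
  case False
  have "(Y, Z) \<in> packet_rel n k V \<Longrightarrow> (Y, Z) \<in> packet_rel n k W"
    if "\<And>X'. X' \<noteq> X \<Longrightarrow> X' \<in> V \<longleftrightarrow> X' \<in> W" for V W
  proof (erule packet_relE)
    fix X' x y
    assume *: "Y = X' - {x}" "Z = X' - {y}" "X' \<in> ksets n (k + 1)" "x \<in> X'" "y \<in> X'"
      "if X' \<in> V then x < y else y < x"
    then have "X' \<noteq> X" using False by (auto simp: packet_eq)
    then show "(Y, Z) \<in> packet_rel n k W" using * that by (auto simp: packet_rel_remove_iff)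
  qed
  from this[of "insert X U" U] this[of U "insert X U"] show ?thesis using False by auto
qed

text \<open>If \<open>p < z < q\<close> with \<open>p, q\<close> in the packet of \<open>X\<close> and \<open>z\<close> outside, then the chain from \<open>p\<close> to \<open>q\<close> is
  the same for \<open>U\<close> and \<open>insert X U\<close>, while one of these two reverses \<open>p\<close> and \<open>q\<close>. Acyclicity of both
  thus makes the packet convex.\<close>

lemma contiguous_linear_extension:
  assumes J: "realizable n k J"
    and U: "U \<in> inversion_sets n k J" "insert X U \<in> inversion_sets n k J"
    and X: "X \<in> full_part n k J" "X \<notin> U"
  obtains us bs vs where "set bs = packet n k X" "set (us @ bs @ vs) = J"
    "linear_extension (packet_rel n k U) (us @ bs @ vs)"
proof -
  let ?R = "packet_rel n k U" and ?P = "packet n k X"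
  have Xk: "X \<in> ksets n (k + 1)" and PJ: "?P \<subseteq> J" using X(1) by (auto simp: full_part_def)
  obtain \<gamma> where \<gamma>: "set \<gamma> = ksets n k" "linear_extension ?R \<gamma>"
    using linear_extension_exists[of n k U] U(1) by (auto simp: inversion_sets_def)
  obtain \<delta> where \<delta>: "set \<delta> = ksets n k" "linear_extension (packet_rel n k (insert X U)) \<delta>"
    using linear_extension_exists[of n k "insert X U"] U(2) by (auto simp: inversion_sets_def)
  \<comment> \<open>An edge with source outside the packet is the same for \<open>U\<close> and
    \<open>insert X U\<close>, so both lists increase along \<open>S\<close>. \<open>B\<close>
    collects the outside sets forced before some packet member by chains that meet the packet only
    at their end.\<close>
  define S where "S = {(Y, Z) \<in> ?R. Y \<notin> ?P}"
  define B where "B = {Z. Z \<notin> ?P \<and> (\<exists>q\<in>?P. (Z, q) \<in> S\<^sup>+)}"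
  have S: "position \<gamma> Y < position \<gamma> Z \<and> position \<delta> Y < position \<delta> Z" if "(Y, Z) \<in> S" for Y Z
    using that linear_extension_position_less[OF \<gamma>(2,1), of Y Z]
      linear_extension_position_less[OF \<delta>(2,1), of Y Z]
    by (auto simp: S_def packet_rel_insert_iff[OF Xk X(2)])
  have S_trancl: "position \<gamma> Y < position \<gamma> Z \<and> position \<delta> Y < position \<delta> Z" if "(Y, Z) \<in> S\<^sup>+" for Y Z
    using that
  proof (induction rule: trancl_induct)
    case (step y z)
    then show ?case using S[of y z] by linarith
  qed (rule S)
  have B_closed: "Y \<in> B" if "(Y, Z) \<in> ?R" "Y \<notin> ?P" "Z \<in> B \<or> Z \<in> ?P" for Y Z
  proof -
    have "(Y, Z) \<in> S" using that by (simp add: S_def)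
    then show ?thesis using that(2,3) unfolding B_def by (blast intro: trancl_into_trancl2)
  qed
  have convex: "(p, Z) \<notin> ?R" if p: "p \<in> ?P" and Z: "Z \<in> B" for p Z
  proof
    assume pZ: "(p, Z) \<in> ?R"
    obtain q where q: "q \<in> ?P" "(Z, q) \<in> S\<^sup>+" "Z \<notin> ?P" using Z by (auto simp: B_def)
    have lt: "position \<gamma> p < position \<gamma> q" "position \<delta> p < position \<delta> q"
      using S_trancl[OF q(2)] linear_extension_position_less[OF \<gamma>(2,1) pZ]
        linear_extension_position_less[OF \<delta>(2,1), of p Z] pZ q(3)
      by (auto simp: packet_rel_insert_iff[OF Xk X(2)])
    then have "p \<noteq> q" by auto
    then have "(p, q) \<in> ?R \<or> (q, p) \<in> ?R"
      using p q(1) X(2) by (auto simp: packet_eq[OF Xk] packet_rel_remove_iff[OF Xk])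
    then have "(q, p) \<in> ?R \<or> (q, p) \<in> packet_rel n k (insert X U)"
      using p q(1) by (auto simp: packet_rel_insert_iff[OF Xk X(2)])
    then show False
      using lt linear_extension_position_less[OF \<gamma>(2,1), of q p]
        linear_extension_position_less[OF \<delta>(2,1), of q p] by auto
  qed
  \<comment> \<open>\<open>B_closed\<close> excludes edges from the third block back to the first
    two, and \<open>convex\<close> those from the packet back to \<open>B\<close>.\<close>
  let ?us = "filter (\<lambda>Z. Z \<in> J \<inter> B) \<gamma>" and ?bs = "filter (\<lambda>Z. Z \<in> ?P) \<gamma>"
    and ?vs = "filter (\<lambda>Z. Z \<in> J - B - ?P) \<gamma>"
  have JU: "J \<subseteq> set \<gamma>" using J \<gamma>(1) by (auto simp: realizable_def)
  have BP: "B \<inter> ?P = {}" by (auto simp: B_def)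
  show thesis
  proof (rule that)
    show "set ?bs = ?P" using PJ JU by auto
    show "set (?us @ ?bs @ ?vs) = J" using PJ JU BP by auto
    have "linear_extension ?R ?us" "linear_extension ?R ?bs" "linear_extension ?R ?vs"
      by (rule restrict_linear_extension[OF \<gamma>(2)])+
    then show "linear_extension ?R (?us @ ?bs @ ?vs)"
      using BP B_closed convex by (auto simp: linear_extension_def sorted_wrt_append)
  qed
qed

text \<open>Reversing the contiguous block changes the order of exactly the pairs inside the packet,
  and these are the pairs whose edges turn around.\<close>

lemma linear_extension_flip:
  assumes X: "X \<in> ksets n (k + 1)" "X \<notin> U" and bs: "set bs = packet n k X"
    and le: "linear_extension (packet_rel n k U) (us @ bs @ vs)"
  shows "linear_extension (packet_rel n k (insert X U)) (us @ rev bs @ vs)"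
proof -
  let ?R = "packet_rel n k U" and ?R' = "packet_rel n k (insert X U)"
  have out: "Y \<notin> packet n k X" if "Y \<in> set us \<union> set vs" for Y
    using that le bs by (auto simp: linear_extension_def)
  have same: "(Z, Y) \<notin> ?R'" if "(Z, Y) \<notin> ?R" "Y \<in> set us \<union> set vs \<or> Z \<in> set us \<union> set vs" for Y Z
    using that out by (auto simp: packet_rel_insert_iff[OF X])
  have "sorted_wrt (\<lambda>x y. (y, x) \<notin> ?R') (rev bs)"
    unfolding sorted_wrt_rev
  proof (rule sorted_wrt_mono_rel)
    show "sorted_wrt (\<lambda>x y. (y, x) \<notin> ?R) bs"
      using le by (simp add: linear_extension_def sorted_wrt_append)
  qed (use bs in \<open>auto simp: packet_rel_insert_iff[OF X]\<close>)
  moreover have "sorted_wrt (\<lambda>x y. (y, x) \<notin> ?R') us" "sorted_wrt (\<lambda>x y. (y, x) \<notin> ?R') vs"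
    using le same
    by (auto simp: linear_extension_def sorted_wrt_append intro: sorted_wrt_mono_rel[rotated])
  ultimately show ?thesis
    using le same by (auto simp: linear_extension_def sorted_wrt_append)
qed

section \<open>Classes of paths and their inversion sets\<close>

lemma Inv_class_in_inversion_sets:
  assumes "0 < k" "r \<in> path_classes n k J"
  shows "Inv_class n k r \<in> inversion_sets n k J"
proof -
  obtain \<gamma> where \<gamma>: "\<gamma> \<in> paths n k J" "r = path_equiv n k J `` {\<gamma>}"
    using assms(2) by (auto simp: path_classes_def elim!: quotientE)
  then have "\<gamma> \<in> r" using equiv_class_self[OF equiv_path_equiv] by blast
  with \<gamma>(1) show ?thesis using Inv_class_eq[OF assms(2)] Inv_in_inversion_sets assms(1) by metis
qed

lemma path_class_eq:
  assumes "r \<in> path_classes n k J" "\<gamma> \<in> r"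
  shows "r = path_equiv n k J `` {\<gamma>}"
proof -
  obtain \<delta> where "r = path_equiv n k J `` {\<delta>}"
    using assms(1) by (auto simp: path_classes_def elim!: quotientE)
  moreover from this have "(\<delta>, \<gamma>) \<in> path_equiv n k J" using assms(2) by simp
  ultimately show ?thesis using equiv_class_eq[OF equiv_path_equiv] by simp
qed

text \<open>Invariance and connectedness make each class a full fibre of \<open>Inv\<close> on the
  paths, so a path is located in a class by its inversion set alone.\<close>

lemma mem_path_class_iff:
  assumes "realizable n k J" "0 < k" "r \<in> path_classes n k J"
  shows "\<gamma> \<in> r \<longleftrightarrow> \<gamma> \<in> paths n k J \<and> Inv n k \<gamma> = Inv_class n k r"
proof -
  obtain \<delta> where \<delta>: "\<delta> \<in> paths n k J" "r = path_equiv n k J `` {\<delta>}"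
    using assms(3) by (auto simp: path_classes_def elim!: quotientE)
  then have "\<delta> \<in> r" using equiv_class_self[OF equiv_path_equiv] by blast
  then have "Inv_class n k r = Inv n k \<delta>" using Inv_class_eq[OF assms(3)] by blast
  then show ?thesis
    using \<delta> path_equiv_if_Inv_eq[OF assms(1,2), of \<delta> \<gamma>] path_equiv_Inv[of \<delta> \<gamma>]
    by (auto simp: path_equiv_def)
qed

lemma bij_betw_Inv_class:
  assumes "realizable n k J" "0 < k"
  shows "bij_betw (Inv_class n k) (path_classes n k J) (inversion_sets n k J)"
proof (rule bij_betw_imageI)
  show "inj_on (Inv_class n k) (path_classes n k J)"
  proof (rule inj_onI)
    fix r r' assume "r \<in> path_classes n k J" "r' \<in> path_classes n k J"
      "Inv_class n k r = Inv_class n k r'"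
    then show "r = r'" using mem_path_class_iff[OF assms] by blast
  qed
  have "U \<in> Inv_class n k ` path_classes n k J" if "U \<in> inversion_sets n k J" for U
  proof -
    obtain \<gamma> where \<gamma>: "\<gamma> \<in> paths n k J" "Inv n k \<gamma> = U"
      using path_exists[OF assms \<open>U \<in> inversion_sets n k J\<close>] by blast
    then have "path_equiv n k J `` {\<gamma>} \<in> path_classes n k J" "\<gamma> \<in> path_equiv n k J `` {\<gamma>}"
      using equiv_class_self[OF equiv_path_equiv] by (auto simp: path_classes_def quotientI)
    then show ?thesis using Inv_class_eq \<gamma>(2) by blast
  qed
  then show "Inv_class n k ` path_classes n k J = inversion_sets n k J"
    using Inv_class_in_inversion_sets[OF assms(2)] by blast
qed

text \<open>The flipped list is a linear extension for the enlarged set, which still obeys the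
  bounds because \<open>X\<close> lies in the full part.\<close>

lemma path_flip:
  assumes J: "realizable n k J" and k: "0 < k" and path: "us @ bs @ vs \<in> paths n k J"
    and X: "X \<in> full_part n k J" "X \<notin> Inv n k (us @ bs @ vs)" and bs: "set bs = packet n k X"
  shows "us @ rev bs @ vs \<in> paths n k J"
    "Inv n k (us @ rev bs @ vs) = insert X (Inv n k (us @ bs @ vs))"
proof -
  let ?U = "Inv n k (us @ bs @ vs)"
  have "X \<in> ksets n (k + 1)" using X(1) by (simp add: full_part_def)
  then have le: "linear_extension (packet_rel n k (insert X ?U)) (us @ rev bs @ vs)"
    using linear_extension_flip[OF _ X(2) bs path_linear_extension[OF path k]] by blast
  have sets: "set (us @ rev bs @ vs) = J" using path by (simp add: paths_def)
  have b: "suffix_part n k J \<subseteq> insert X ?U" "insert X ?U \<subseteq> suffix_part n k J \<union> full_part n k J"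
    using Inv_bounds[OF path] X(1) by auto
  show "us @ rev bs @ vs \<in> paths n k J" using linear_extension_path[OF J b le sets] .
  show "Inv n k (us @ rev bs @ vs) = insert X ?U" using linear_extension_Inv[OF J k b le sets] .
qed

text \<open>A flip adds exactly \<open>X\<close>. Conversely, if both inversion sets are realizable,
  some path with the smaller one has the packet of \<open>X\<close> as a block; it lies in
  \<open>r\<close>, and its flip lies in \<open>r'\<close>.\<close>

lemma MS_step_iff_single_step:
  assumes J: "realizable n k J" and k: "0 < k"
    and r: "r \<in> path_classes n k J" "r' \<in> path_classes n k J"
  shows "MS_step n k J r r' \<longleftrightarrow>
    single_step (inversion_sets n k J) (Inv_class n k r) (Inv_class n k r')"
proof
  assume "MS_step n k J r r'"
  then obtain X us bs vs where X: "X \<in> full_part n k J" "X \<notin> Inv_class n k r"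
    "us @ bs @ vs \<in> r" "set bs = packet n k X" "r' = path_equiv n k J `` {us @ rev bs @ vs}"
    unfolding MS_step_def packet_flip_def by blast
  then have \<gamma>: "us @ bs @ vs \<in> paths n k J" "Inv n k (us @ bs @ vs) = Inv_class n k r"
    using mem_path_class_iff[OF J k r(1)] by auto
  have flip: "us @ rev bs @ vs \<in> paths n k J"
    "Inv n k (us @ rev bs @ vs) = insert X (Inv_class n k r)"
    using path_flip[OF J k \<gamma>(1) X(1) _ X(4)] \<gamma>(2) X(2) by auto
  then have "us @ rev bs @ vs \<in> r'" unfolding X(5) by (intro equiv_class_self[OF equiv_path_equiv])
  then have "Inv_class n k r' = insert X (Inv_class n k r)"
    using Inv_class_eq[OF r(2)] flip(2) by simp
  moreover have "insert X A - A = {X}" if "X \<notin> A" for A using that by auto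
  ultimately show "single_step (inversion_sets n k J) (Inv_class n k r) (Inv_class n k r')"
    using Inv_class_in_inversion_sets[OF k r(1)] Inv_class_in_inversion_sets[OF k r(2)] X(2)
    by (auto simp: single_step_def)
next
  let ?U = "Inv_class n k r" and ?V = "Inv_class n k r'"
  assume "single_step (inversion_sets n k J) ?U ?V"
  then have UV: "?U \<in> inversion_sets n k J" "?V \<in> inversion_sets n k J" "?U \<subset> ?V" "card (?V - ?U) = 1"
    by (auto simp: single_step_def)
  then obtain X where "?V - ?U = {X}" by (auto simp: card_1_singleton_iff)
  then have V: "?V = insert X ?U" "X \<notin> ?U" using UV(3) by auto
  \<comment> \<open>The smaller set already contains \<open>J\<^sub>s\<close>, so a new element can
    only come from \<open>J\<^sub>F\<close>.\<close>
  then have X: "X \<in> full_part n k J" using UV(1,2) by (auto simp: inversion_sets_def)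
  obtain us bs vs where g: "set bs = packet n k X" "set (us @ bs @ vs) = J"
    "linear_extension (packet_rel n k ?U) (us @ bs @ vs)"
    using contiguous_linear_extension[OF J UV(1) _ X V(2)] UV(2) V(1) by metis
  have path: "us @ bs @ vs \<in> paths n k J" and inv: "Inv n k (us @ bs @ vs) = ?U"
    using linear_extension_path[OF J _ _ g(3,2)] linear_extension_Inv[OF J k _ _ g(3,2)] UV(1)
    by (auto simp: inversion_sets_def)
  have "us @ bs @ vs \<in> r" using path inv mem_path_class_iff[OF J k r(1)] by simp
  moreover have "us @ rev bs @ vs \<in> r'"
    using path_flip[OF J k path X _ g(1)] inv V mem_path_class_iff[OF J k r(2)] by simp
  then have "r' = path_equiv n k J `` {us @ rev bs @ vs}"
    by (rule path_class_eq[OF r(2)])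
  ultimately show "MS_step n k J r r'"
    using X V(2) g(1) r unfolding MS_step_def packet_flip_def by blast
qed

text \<open>Chains of \<open>t\<close> stay in \<open>B\<close> and lift step by step through the
  bijection. Antisymmetry on both sides comes from inclusion.\<close>

lemma poset_iso_rtranclp:
  assumes f: "bij_betw f A B"
    and s: "\<And>x y. s x y \<Longrightarrow> x \<in> A \<and> y \<in> A"
    and t: "\<And>U V. t U V \<Longrightarrow> U \<in> B \<and> V \<in> B \<and> U \<subseteq> V"
    and st: "\<And>x y. x \<in> A \<Longrightarrow> y \<in> A \<Longrightarrow> s x y \<longleftrightarrow> t (f x) (f y)"
  shows "poset_iso A {(x, y). x \<in> A \<and> y \<in> A \<and> s\<^sup>*\<^sup>* x y} B {(U, V). U \<in> B \<and> V \<in> B \<and> t\<^sup>*\<^sup>* U V} f"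
proof -
  have t_le: "U \<subseteq> V" if "t\<^sup>*\<^sup>* U V" for U V
    using that by (induction rule: rtranclp_induct) (use t in blast)+
  have to: "y \<in> A \<and> t\<^sup>*\<^sup>* (f x) (f y)" if "s\<^sup>*\<^sup>* x y" "x \<in> A" for x y
    using that
  proof (induction rule: rtranclp_induct)
    case (step y z)
    then show ?case using s st by (meson rtranclp.rtrancl_into_rtrancl)
  qed simp
  have from_t: "\<exists>y\<in>A. V = f y \<and> s\<^sup>*\<^sup>* x y" if "t\<^sup>*\<^sup>* (f x) V" "x \<in> A" for x V
    using that
  proof (induction rule: rtranclp_induct)
    case (step V W)
    then obtain y where y: "y \<in> A" "V = f y" "s\<^sup>*\<^sup>* x y" by blast
    obtain z where z: "z \<in> A" "W = f z"
      using t[OF step.hyps(2)] f by (auto simp: bij_betw_def)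
    then have "s y z" using y step.hyps(2) st by simp
    with y(3) have "s\<^sup>*\<^sup>* x z" by (rule rtranclp.rtrancl_into_rtrancl)
    then show ?case using z by blast
  qed auto
  have iff: "s\<^sup>*\<^sup>* x y \<longleftrightarrow> t\<^sup>*\<^sup>* (f x) (f y)" if "x \<in> A" "y \<in> A" for x y
    using to[of x y] from_t[of x "f y"] that f by (auto simp: bij_betw_def inj_on_def)
  have anti: "x = y" if "x \<in> A" "y \<in> A" "s\<^sup>*\<^sup>* x y" "s\<^sup>*\<^sup>* y x" for x y
    using that to[of x y] to[of y x] t_le f by (metis bij_betw_def inj_on_def subset_antisym)
  have "partial_order_on A {(x, y). x \<in> A \<and> y \<in> A \<and> s\<^sup>*\<^sup>* x y}"
    using anti by (auto simp: partial_order_on_def preorder_on_def refl_on_def trans_def antisym_def)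
  moreover have "partial_order_on B {(U, V). U \<in> B \<and> V \<in> B \<and> t\<^sup>*\<^sup>* U V}"
    using t_le by (auto simp: partial_order_on_def preorder_on_def refl_on_def trans_def antisym_def)
  ultimately show ?thesis using f iff by (auto simp: poset_iso_def bij_betw_def)
qed

theorem theorem3p22:
  fixes n k :: nat and J :: "nat set set"
  assumes "1 < k" and "k \<le> n" and "realizable n k J"
  shows "poset_iso (path_classes n k J) (MS_order n k J)
           (inversion_sets n k J) (single_step_order (inversion_sets n k J))
           (Inv_class n k)"
  unfolding MS_order_def single_step_order_def
proof (rule poset_iso_rtranclp)
  show "bij_betw (Inv_class n k) (path_classes n k J) (inversion_sets n k J)"
    using bij_betw_Inv_class assms by simp
  show "MS_step n k J r r' \<longleftrightarrow>
      single_step (inversion_sets n k J) (Inv_class n k r) (Inv_class n k r')"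
    if "r \<in> path_classes n k J" "r' \<in> path_classes n k J" for r r'
    using MS_step_iff_single_step that assms by simp
qed (auto simp: MS_step_def single_step_def)

end
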